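(* Let $K$ be an H-field with composition and inversion over $\mathbb{R}$ (so $C=\mathrm{Ker}(\partial)=\mathbb{R}$). Let $\mathcal{G}_0,\mathcal{G}_1\subseteq K^{>\mathbb{R}}$ be such that: $\mathcal{G}_0$ is a normal convex subgroup of the ordered group $(K^{>\mathbb{R}},\circ,x,<)$ containing $x+r$ for every $r\in\mathbb{R}$; $\mathcal{G}_1$ is a complement of $\mathcal{G}_0$ in $K^{>\mathbb{R}}$ (a subgroup with $\mathcal{G}_0\cap\mathcal{G}_1=\{x\}$ and $\mathcal{G}_0\circ\mathcal{G}_1=K^{>\mathbb{R}}$) which, with the induced order, is a growth order group with Archimedean centralisers; and the set $\{a\circ(a^{\mathrm{inv}}+1): a\in\mathcal{G}_1\}$ is cofinal in $\mathcal{G}_0$. Then $(K^{>\mathbb{R}},\circ,x,<)$ is a growth order group with Archimedean centralisers, and $\mathcal{G}_0$ is a growth order group which is $\preccurlyeq$-initial in $K^{>\mathbb{R}}$.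
   Context: An H-field is an ordered field $K$ with a convex valuation ring $\mathcal{O}$ with maximal ideal $\mathcal{o}$, and a derivation $\partial: K\to K$, $a\mapsto a'$, such that (HF1) for every $a\in\mathcal{O}$ there is $c\in C:=\mathrm{Ker}(\partial)$ with $a-c\in\mathcal{o}$, and (HF2) if $a>C$ then $a'>0$. Write $K^{>C}=\{a\in K: a>c \text{ for all } c\in C\}$, $\mathcal{o}(a)=\{\varepsilon a:\varepsilon\in\mathcal{o}\}$, $a^{\dagger}=a'/a$ for $a\neq 0$, and $a^{(k)}$ for the $k$-th derivative. An H-field with composition is an H-field with a fixed $x\in K^{>C}$ with $x'=1$ and a map $\circ: K\times K^{>C}\to K$ such that: (HFC1) for each $b\in K^{>C}$, $a\mapsto a\circ b$ is a $C$-linear morphism of ordered rings $K\to K$; (HFC2) $a\circ(b\circ d)=(a\circ b)\circ d$ for $a\in K$, $b,d\in K^{>C}$; (HFC3) for each $a\in K^{>C}$, $b\mapsto a\circ b$ is a strictly increasing map $K^{>C}\to K^{>C}$; (HFC4) $a\circ x=a$ and $x\circ b=b$ for $a\in K$, $b\in K^{>C}$; (HFC5) for $a,\delta\in K$ and $b\in K^{>C}$ with $\delta\in\mathcal{o}(a)$ and $(a^{\dagger}\circ b)\delta\in\mathcal{o}$, for all $n\in\mathbb{N}$, $a\circ(b+\delta)-\sum_{k\leqslant n}\frac{a^{(k)}\circ b}{k!}\delta^k\in\mathcal{o}((a^{(n)}\circ b)\delta^n)$. It has inversion if $(K^{>C},\circ,x)$ is a group (then it is an ordered group with the order of $K$);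 $a^{\mathrm{inv}}$ denotes the inverse. Group-theoretic notions: in an ordered group $\mathcal{G}$ (group with linear order with $g>h\Rightarrow fg>fh\wedge gf>hf$), $\mathcal{C}(g)$ is the centraliser, $\mathcal{G}^{>}=\{f>1\}$; $f\preccurlyeq g$ iff $f=1$, or $g\neq 1$ and $g_0\leqslant f\leqslant g_1$ for some $g_0,g_1\in\mathcal{C}(g)$; $f\asymp g$ iff $f\preccurlyeq g\preccurlyeq f$; $f\prec g$ iff $f\preccurlyeq g$ and not $g\preccurlyeq f$; for $g,h\neq1$, $g\sim h$ iff $gh^{-1}\prec g$; $\mathcal{s}\in\mathcal{G}^{>}$ is scaling if $\mathcal{C}(\mathcal{s})$ is Abelian and each $f\asymp\mathcal{s}$ has some $g\in\mathcal{C}(\mathcal{s})\setminus\{1\}$ with $g\sim f$. A growth order group satisfies (GOG1) for $f,g\in\mathcal{G}^{>}$, $f\geqslant g$, $g_0\in\mathcal{C}(g)$ there is $f_0\in\mathcal{C}(f)$ with $f_0\geqslant g_0$; (GOG2) for $f,g\in\mathcal{G}^{>}$, $f>\mathcal{C}(g)$ implies $fg>gf$; (GOG3) every $f\neq1$ has a scaling $\mathcal{s}\asymp f$. Archimedean centralisers: $\mathcal{C}(g)$ is Archimedean for every $g\neq 1$. A subset $N$ is $\preccurlyeq$-initial if it is non-empty and $f\in N$, $g\preccurlyeq f$ imply $g\in N$. *)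

theory Defs
  imports Complex_Main "HOL-Algebra.Coset"
begin

section \<open>Ordered sets\<close>

definition convex_in :: "'a::linorder set \<Rightarrow> 'a set \<Rightarrow> bool"
  where "convex_in A S \<longleftrightarrow> S \<subseteq> A \<and> (\<forall>a\<in>S. \<forall>b\<in>S. \<forall>c\<in>A. a \<le> c \<and> c \<le> b \<longrightarrow> c \<in> S)"

definition cofinal_in :: "'a::linorder set \<Rightarrow> 'a set \<Rightarrow> bool"
  where "cofinal_in A S \<longleftrightarrow> S \<subseteq> A \<and> (\<forall>a\<in>A. \<exists>s\<in>S. a \<le> s)"

section \<open>Ordered groups\<close>

text \<open>
  The order of an ordered group is the order of the type of its elements, restricted to the
  carrier. Hence the structure \<open>G\<lparr>carrier := H\<rparr>\<close> is the subgroup \<open>H\<close> with the induced order, and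
  all notions below, when applied to it, are relative to \<open>H\<close> (centralisers are taken in \<open>H\<close>, etc.).
\<close>

locale ordered_group = group G
  for G :: "('a::linorder, 'b) monoid_scheme" (structure) +
  assumes mult_less_left:
      "\<lbrakk>f \<in> carrier G; g \<in> carrier G; h \<in> carrier G; h < g\<rbrakk> \<Longrightarrow> f \<otimes> h < f \<otimes> g"
    and mult_less_right:
      "\<lbrakk>f \<in> carrier G; g \<in> carrier G; h \<in> carrier G; h < g\<rbrakk> \<Longrightarrow> h \<otimes> f < g \<otimes> f"

locale archimedean_group = ordered_group G
  for G :: "('a::linorder, 'b) monoid_scheme" (structure) +
  assumes archimedean:
      "\<lbrakk>f \<in> carrier G; g \<in> carrier G; \<one> < g\<rbrakk> \<Longrightarrow> \<exists>n::nat. f \<le> g [^] n"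

definition centraliser :: "('a, 'b) monoid_scheme \<Rightarrow> 'a \<Rightarrow> 'a set"
  where "centraliser G g = {h \<in> carrier G. g \<otimes>\<^bsub>G\<^esub> h = h \<otimes>\<^bsub>G\<^esub> g}"

definition gr_preceq :: "('a::linorder, 'b) monoid_scheme \<Rightarrow> 'a \<Rightarrow> 'a \<Rightarrow> bool"
    (infix \<open>\<preceq>\<index>\<close> 50)
  where "f \<preceq>\<^bsub>G\<^esub> g \<longleftrightarrow> f = \<one>\<^bsub>G\<^esub> \<or>
    (g \<noteq> \<one>\<^bsub>G\<^esub> \<and> (\<exists>g0\<in>centraliser G g. \<exists>g1\<in>centraliser G g. g0 \<le> f \<and> f \<le> g1))"

definition gr_asymp :: "('a::linorder, 'b) monoid_scheme \<Rightarrow> 'a \<Rightarrow> 'a \<Rightarrow> bool"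
    (infix \<open>\<asymp>\<index>\<close> 50)
  where "f \<asymp>\<^bsub>G\<^esub> g \<longleftrightarrow> f \<preceq>\<^bsub>G\<^esub> g \<and> g \<preceq>\<^bsub>G\<^esub> f"

definition gr_prec :: "('a::linorder, 'b) monoid_scheme \<Rightarrow> 'a \<Rightarrow> 'a \<Rightarrow> bool"
    (infix \<open>\<prec>\<index>\<close> 50)
  where "f \<prec>\<^bsub>G\<^esub> g \<longleftrightarrow> f \<preceq>\<^bsub>G\<^esub> g \<and> \<not> g \<preceq>\<^bsub>G\<^esub> f"

definition gr_sim :: "('a::linorder, 'b) monoid_scheme \<Rightarrow> 'a \<Rightarrow> 'a \<Rightarrow> bool"
    (infix \<open>\<sim>\<index>\<close> 50)
  where "g \<sim>\<^bsub>G\<^esub> h \<longleftrightarrow>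
    g \<noteq> \<one>\<^bsub>G\<^esub> \<and> h \<noteq> \<one>\<^bsub>G\<^esub> \<and> g \<otimes>\<^bsub>G\<^esub> inv\<^bsub>G\<^esub> h \<prec>\<^bsub>G\<^esub> g"

definition scaling :: "('a::linorder, 'b) monoid_scheme \<Rightarrow> 'a \<Rightarrow> bool"
  where "scaling G s \<longleftrightarrow> s \<in> carrier G \<and> \<one>\<^bsub>G\<^esub> < s \<and>
    comm_group (G\<lparr>carrier := centraliser G s\<rparr>) \<and>
    (\<forall>f\<in>carrier G. f \<asymp>\<^bsub>G\<^esub> s \<longrightarrow> (\<exists>g\<in>centraliser G s - {\<one>\<^bsub>G\<^esub>}. g \<sim>\<^bsub>G\<^esub> f))"

locale growth_order_group = ordered_group G
  for G :: "('a::linorder, 'b) monoid_scheme" (structure) +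
  assumes GOG1:
      "\<lbrakk>f \<in> carrier G; g \<in> carrier G; \<one> < f; \<one> < g; g \<le> f; g0 \<in> centraliser G g\<rbrakk>
       \<Longrightarrow> \<exists>f0\<in>centraliser G f. g0 \<le> f0"
    and GOG2:
      "\<lbrakk>f \<in> carrier G; g \<in> carrier G; \<one> < f; \<one> < g; \<forall>h\<in>centraliser G g. h < f\<rbrakk>
       \<Longrightarrow> g \<otimes> f < f \<otimes> g"
    and GOG3:
      "\<lbrakk>f \<in> carrier G; f \<noteq> \<one>\<rbrakk> \<Longrightarrow> \<exists>s. scaling G s \<and> s \<asymp> f"

definition archimedean_centralisers :: "('a::linorder, 'b) monoid_scheme \<Rightarrow> bool"
  where "archimedean_centralisers G \<longleftrightarrow>
    (\<forall>g\<in>carrier G. g \<noteq> \<one>\<^bsub>G\<^esub> \<longrightarrow> archimedean_group (G\<lparr>carrier := centraliser G g\<rparr>))"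

definition preceq_initial :: "('a::linorder, 'b) monoid_scheme \<Rightarrow> 'a set \<Rightarrow> bool"
  where "preceq_initial G N \<longleftrightarrow> N \<subseteq> carrier G \<and> N \<noteq> {} \<and>
    (\<forall>f\<in>N. \<forall>g\<in>carrier G. g \<preceq>\<^bsub>G\<^esub> f \<longrightarrow> g \<in> N)"

definition complement_in :: "('a, 'b) monoid_scheme \<Rightarrow> 'a set \<Rightarrow> 'a set \<Rightarrow> bool"
  where "complement_in G N H \<longleftrightarrow>
    subgroup H G \<and> N \<inter> H = {\<one>\<^bsub>G\<^esub>} \<and> N <#>\<^bsub>G\<^esub> H = carrier G"

section \<open>H-fields\<close>

text \<open>The field \<open>K\<close> is the whole type.\<close>

locale convex_valuation_ring =
  fixes \<O> :: "'k::linordered_field set"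
  assumes one_in: "1 \<in> \<O>"
    and diff_in: "\<lbrakk>a \<in> \<O>; b \<in> \<O>\<rbrakk> \<Longrightarrow> a - b \<in> \<O>"
    and mult_in: "\<lbrakk>a \<in> \<O>; b \<in> \<O>\<rbrakk> \<Longrightarrow> a * b \<in> \<O>"
    and valuation: "a \<noteq> 0 \<Longrightarrow> a \<in> \<O> \<or> inverse a \<in> \<O>"
    and convex: "convex_in UNIV \<O>"

text \<open>The maximal ideal of a valuation ring is its set of non-units.\<close>

definition max_ideal :: "'k::linordered_field set \<Rightarrow> 'k set"
  where "max_ideal \<O> = {a \<in> \<O>. \<not> (\<exists>b\<in>\<O>. a * b = 1)}"

text \<open>\<open>small \<O> a\<close> is the set usually written \<open>o(a)\<close>.\<close>

definition small :: "'k::linordered_field set \<Rightarrow> 'k \<Rightarrow> 'k set"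
  where "small \<O> a = {\<epsilon> * a | \<epsilon>. \<epsilon> \<in> max_ideal \<O>}"

definition constants :: "('k::linordered_field \<Rightarrow> 'k) \<Rightarrow> 'k set"
  where "constants D = {c. D c = 0}"

definition above_constants :: "('k::linordered_field \<Rightarrow> 'k) \<Rightarrow> 'k set"
  where "above_constants D = {a. \<forall>c\<in>constants D. c < a}"

locale H_field = convex_valuation_ring \<O>
  for \<O> :: "'k::linordered_field set" +
  fixes D :: "'k \<Rightarrow> 'k"
  assumes D_add: "D (a + b) = D a + D b"
    and D_mult: "D (a * b) = D a * b + a * D b"
    and HF1: "a \<in> \<O> \<Longrightarrow> \<exists>c\<in>constants D. a - c \<in> max_ideal \<O>"
    and HF2: "a \<in> above_constants D \<Longrightarrow> 0 < D a"

text \<open>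
  The composition is only meaningful for a second argument in \<open>above_constants D\<close>; its values
  elsewhere are arbitrary and unconstrained. This is why \<open>HFC5\<close> requires
  \<open>b + \<delta> \<in> above_constants D\<close>: otherwise \<open>a \<odot> (b + \<delta>)\<close> is undefined.
\<close>

locale H_field_with_composition = H_field \<O> D
  for \<O> :: "'k::linordered_field set" and D :: "'k \<Rightarrow> 'k" +
  fixes x :: 'k
    and cmp :: "'k \<Rightarrow> 'k \<Rightarrow> 'k" (infixl \<open>\<odot>\<close> 72)
  assumes x_above: "x \<in> above_constants D"
    and D_x: "D x = 1"
    and HFC1_add: "b \<in> above_constants D \<Longrightarrow> (a1 + a2) \<odot> b = a1 \<odot> b + a2 \<odot> b"
    and HFC1_mult: "b \<in> above_constants D \<Longrightarrow> (a1 * a2) \<odot> b = (a1 \<odot> b) * (a2 \<odot> b)"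
    and HFC1_one: "b \<in> above_constants D \<Longrightarrow> 1 \<odot> b = 1"
    and HFC1_linear: "\<lbrakk>b \<in> above_constants D; c \<in> constants D\<rbrakk> \<Longrightarrow> (c * a) \<odot> b = c * (a \<odot> b)"
    and HFC1_mono: "b \<in> above_constants D \<Longrightarrow> mono (\<lambda>a. a \<odot> b)"
    and HFC2: "\<lbrakk>b \<in> above_constants D; d \<in> above_constants D\<rbrakk> \<Longrightarrow> a \<odot> (b \<odot> d) = (a \<odot> b) \<odot> d"
    and HFC3_closed:
      "\<lbrakk>a \<in> above_constants D; b \<in> above_constants D\<rbrakk> \<Longrightarrow> a \<odot> b \<in> above_constants D"
    and HFC3_strict_mono:
      "a \<in> above_constants D \<Longrightarrow> strict_mono_on (above_constants D) (\<lambda>b. a \<odot> b)"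
    and HFC4_right: "a \<odot> x = a"
    and HFC4_left: "b \<in> above_constants D \<Longrightarrow> x \<odot> b = b"
    and HFC5:
      "\<lbrakk>b \<in> above_constants D; b + \<delta> \<in> above_constants D;
        \<delta> \<in> small \<O> a; ((D a / a) \<odot> b) * \<delta> \<in> max_ideal \<O>\<rbrakk>
       \<Longrightarrow> a \<odot> (b + \<delta>) - (\<Sum>k\<le>n. ((D ^^ k) a \<odot> b) / fact k * \<delta> ^ k)
           \<in> small \<O> (((D ^^ n) a \<odot> b) * \<delta> ^ n)"

definition composition_group ::
    "('k::linordered_field \<Rightarrow> 'k) \<Rightarrow> 'k \<Rightarrow> ('k \<Rightarrow> 'k \<Rightarrow> 'k) \<Rightarrow> 'k monoid"
  where "composition_group D x cmp = \<lparr>carrier = above_constants D, mult = cmp, one = x\<rparr>"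

locale H_field_with_inversion = H_field_with_composition +
  assumes inversion: "group (composition_group D x cmp)"

end

(*
  Call an ordered group steep if g f < f g whenever g > 1 and f exceeds every power of g. In a steep
  group the relation f \<preceq> g says that f lies between two powers of g, so steepness gives Archimedean
  centralisers, GOG1 and GOG2, and it passes to subgroups. The complement yields a monotone
  retraction of the composition group onto G1 with kernel G0, through which steepness and scaling
  elements lift; what remains is steepness for g in G0, and a scaling element for each f in G0.

  By the cofinality hypothesis and a Taylor expansion, every f > x in G0 is conjugate to x + 1 + e
  with e infinitesimal, and x + 1 is scaling because C(x + 1) consists of the real translations.
  If f > G0 one can take g = x + 1 + e; then f - x dominates a rational multiple of x and g f < f g
  is a comparison of increasing functions. If f lies in G0 one can take f = x + 1 + e and g = x + d
  with d infinitesimal, and compares the decrease of d under f with the variation of e under g.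
*)
theory Submission
  imports Defs
begin

section \<open>Steep ordered groups\<close>

text \<open>Centralisers depend on the ambient group and are hard to compute under composition,
  while powers are carried along by homomorphisms; hence the detour through powers. The analytic
  obstacle is that \<open>e\<close> in \<open>x + 1 + e\<close> is known only to be infinitesimal,
  so nothing bounds \<open>D e\<close> in terms of \<open>d\<close>, and expanding \<open>e\<close>
  itself is of no use. Taylor expansion is therefore applied to infinite elements only, to first
  order, and other comparisons are drawn from one principle: an infinite \<open>u\<close> satisfies
  \<open>u < u \<odot> g\<close> whenever \<open>g > x\<close>. Auxiliary elements \<open>u\<close>
  such as \<open>2 * n * f - (2 * n + 1) * x\<close>, \<open>x / (h * h)\<close> or
  \<open>y * (1 + 32 * e)\<close> turn it into the estimates that are needed. The numerical
  constants only leave slack for infinitesimal terms.\<close>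

context ordered_group
begin

lemma mult_le_left:
  "\<lbrakk>f \<in> carrier G; g \<in> carrier G; h \<in> carrier G; h \<le> g\<rbrakk> \<Longrightarrow> f \<otimes> h \<le> f \<otimes> g"
  by (metis mult_less_left le_less)

lemma mult_le_right:
  "\<lbrakk>f \<in> carrier G; g \<in> carrier G; h \<in> carrier G; h \<le> g\<rbrakk> \<Longrightarrow> h \<otimes> f \<le> g \<otimes> f"
  by (metis mult_less_right le_less)

lemma mult_mono_group:
  assumes "a \<in> carrier G" "b \<in> carrier G" "c \<in> carrier G" "d \<in> carrier G" "a \<le> b" "c \<le> d"
  shows "a \<otimes> c \<le> b \<otimes> d"
  using assms by (meson mult_le_left mult_le_right order_trans)

lemma mult_less_left_iff:
  "\<lbrakk>f \<in> carrier G; g \<in> carrier G; h \<in> carrier G\<rbrakk> \<Longrightarrow> f \<otimes> h < f \<otimes> g \<longleftrightarrow> h < g"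
  by (meson mult_less_left mult_le_left not_le)

lemma mult_less_right_iff:
  "\<lbrakk>f \<in> carrier G; g \<in> carrier G; h \<in> carrier G\<rbrakk> \<Longrightarrow> h \<otimes> f < g \<otimes> f \<longleftrightarrow> h < g"
  by (meson mult_less_right mult_le_right not_le)

lemma inv_less_iff:
  assumes [simp]: "a \<in> carrier G" "b \<in> carrier G"
  shows "inv b < inv a \<longleftrightarrow> a < b"
proof -
  have "inv b < inv a \<longleftrightarrow> inv b \<otimes> a < inv a \<otimes> a"
    by (rule mult_less_right_iff[symmetric]) simp_all
  also have "\<dots> \<longleftrightarrow> inv b \<otimes> a < inv b \<otimes> b"
    by simp
  also have "\<dots> \<longleftrightarrow> a < b"
    by (rule mult_less_left_iff) simp_all
  finally show ?thesis .
qed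

lemma inv_le_iff: "\<lbrakk>a \<in> carrier G; b \<in> carrier G\<rbrakk> \<Longrightarrow> inv b \<le> inv a \<longleftrightarrow> a \<le> b"
  using inv_less_iff[of b a] by (simp add: not_less[symmetric])

lemma pow_mono_base:
  fixes n :: nat
  assumes "a \<in> carrier G" "b \<in> carrier G" "a \<le> b"
  shows "a [^] n \<le> b [^] n"
  using assms by (induction n) (auto intro: mult_mono_group)

lemma pow_mono_exp:
  fixes m n :: nat
  assumes [simp]: "a \<in> carrier G" and "\<one> \<le> a" "m \<le> n"
  shows "a [^] m \<le> a [^] n"
  using \<open>m \<le> n\<close>
proof (induction n rule: dec_induct)
  case (step n)
  have "a [^] n \<otimes> \<one> \<le> a [^] n \<otimes> a"
    using assms by (intro mult_le_left) auto
  with step.IH show ?case by simp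
qed simp

lemma one_le_pow: "\<lbrakk>a \<in> carrier G; \<one> \<le> a\<rbrakk> \<Longrightarrow> \<one> \<le> a [^] (n::nat)"
  using pow_mono_exp[of a 0 n] by simp

lemma pow_less_pow_Suc:
  assumes [simp]: "a \<in> carrier G" and "\<one> < a"
  shows "a [^] n < a [^] Suc n"
  using mult_less_left[of "a [^] n" a \<one>] assms by simp

lemma centraliser_subgroup:
  assumes [simp]: "g \<in> carrier G"
  shows "subgroup (centraliser G g) G"
proof
  show "centraliser G g \<subseteq> carrier G" by (auto simp: centraliser_def)
next
  fix a b assume ab: "a \<in> centraliser G g" "b \<in> centraliser G g"
  then have [simp]: "a \<in> carrier G" "b \<in> carrier G" by (auto simp: centraliser_def)
  from ab show "a \<otimes> b \<in> centraliser G g"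
    by (simp add: centraliser_def) (metis assms m_assoc \<open>a \<in> carrier G\<close> \<open>b \<in> carrier G\<close>)
next
  show "\<one> \<in> centraliser G g" by (simp add: centraliser_def)
next
  fix a assume a: "a \<in> centraliser G g"
  then have [simp]: "a \<in> carrier G" by (auto simp: centraliser_def)
  from a have "g = a \<otimes> g \<otimes> inv a"
    by (simp add: centraliser_def inv_solve_right)
  then have "inv a \<otimes> g = g \<otimes> inv a"
    using inv_solve_left[of "g \<otimes> inv a" a g] by (simp add: m_assoc)
  then show "inv a \<in> centraliser G g" by (simp add: centraliser_def)
qed

lemma centraliser_sym:
  "\<lbrakk>h \<in> centraliser G g; g \<in> carrier G\<rbrakk> \<Longrightarrow> g \<in> centraliser G h"
  by (simp add: centraliser_def)

lemma centraliser_self: "g \<in> carrier G \<Longrightarrow> g \<in> centraliser G g"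
  by (simp add: centraliser_def)

lemma centraliser_inv:
  assumes "g \<in> carrier G"
  shows "centraliser G (inv g) = centraliser G g"
proof -
  have "h \<in> centraliser G (inv g)" if "h \<in> centraliser G g" "g \<in> carrier G" for g h
  proof -
    have h: "h \<in> carrier G" using that by (simp add: centraliser_def)
    have "inv g \<in> centraliser G h"
      using centraliser_subgroup[OF h] centraliser_sym[OF that] by (rule subgroup.m_inv_closed)
    then show ?thesis using h by (rule centraliser_sym)
  qed
  from this[of _ g] this[of _ "inv g"] assms show ?thesis by auto
qed

lemma pow_centraliser: "g \<in> carrier G \<Longrightarrow> g [^] (n::nat) \<in> centraliser G g"
  using nat_pow_Suc2[of g n] by (simp add: centraliser_def)

definition group_abs :: "'a \<Rightarrow> 'a" where "group_abs f = (if f < \<one> then inv f else f)"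

lemma one_le_group_abs: "f \<in> carrier G \<Longrightarrow> \<one> \<le> group_abs f"
  using inv_less_iff[of f \<one>] by (auto simp: group_abs_def)

lemma group_abs_closed [simp]: "f \<in> carrier G \<Longrightarrow> group_abs f \<in> carrier G"
  by (simp add: group_abs_def)

lemma group_abs_eq_one_iff [simp]: "f \<in> carrier G \<Longrightarrow> group_abs f = \<one> \<longleftrightarrow> f = \<one>"
  by (auto simp: group_abs_def inv_eq_1_iff)

text \<open>Centralisers are closed under inverses, \<open>g\<close> and \<open>inv g\<close> have
  the same one, and inversion reverses the order; so bounds for \<open>f\<close> turn into bounds
  for \<open>inv f\<close>, and it suffices to compare elements above \<open>\<one>\<close>.\<close>

lemma preceq_group_abs:
  assumes [simp]: "f \<in> carrier G" "g \<in> carrier G"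
  shows "f \<preceq> g \<longleftrightarrow> group_abs f \<preceq> group_abs g"
proof -
  have 1: "f \<preceq> inv g \<longleftrightarrow> f \<preceq> g" for f
    by (auto simp: gr_preceq_def centraliser_inv)
  have imp: "inv f \<preceq> g" if "f \<preceq> g" and [simp]: "f \<in> carrier G" for f
  proof (cases "f = \<one>")
    case False
    with that obtain a b where ab: "g \<noteq> \<one>" "a \<in> centraliser G g" "b \<in> centraliser G g" "a \<le> f" "f \<le> b"
      by (auto simp: gr_preceq_def)
    then have [simp]: "a \<in> carrier G" "b \<in> carrier G" by (auto simp: centraliser_def)
    have "inv a \<in> centraliser G g" "inv b \<in> centraliser G g"
      using ab centraliser_subgroup[of g] by (auto intro: subgroup.m_inv_closed)
    moreover have "inv b \<le> inv f" "inv f \<le> inv a"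
      using ab by (simp_all add: inv_le_iff)
    ultimately show ?thesis using ab(1) unfolding gr_preceq_def by blast
  qed (simp add: gr_preceq_def)
  from imp[of f] imp[of "inv f"] have 2: "inv f \<preceq> g \<longleftrightarrow> f \<preceq> g" by auto
  show ?thesis by (auto simp: group_abs_def 1 2)
qed

lemma ordered_group_subgroup:
  assumes "subgroup H G"
  shows "ordered_group (G\<lparr>carrier := H\<rparr>)"
proof -
  interpret H: group "G\<lparr>carrier := H\<rparr>" using assms by (rule subgroup_imp_group)
  have "H \<subseteq> carrier G" using assms by (rule subgroup.subset)
  then show ?thesis
    by unfold_locales (auto intro!: mult_less_left mult_less_right simp: subset_eq)
qed

end

text \<open>Quantifying over powers of \<open>g\<close> keeps the condition independent of the
  ambient group: powers are the same in every subgroup and are preserved by homomorphisms.\<close>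

locale steep_group = ordered_group G
  for G :: "('a::linorder, 'b) monoid_scheme" (structure) +
  assumes steep:
    "\<lbrakk>f \<in> carrier G; g \<in> carrier G; \<one> < f; \<one> < g; \<forall>n::nat. g [^] n < f\<rbrakk> \<Longrightarrow> g \<otimes> f < f \<otimes> g"
begin

text \<open>By steepness an element above every power of \<open>g\<close> cannot commute with
  \<open>g\<close>; the exponent 0 supplies \<open>\<one> < h\<close>.\<close>

lemma centraliser_le_pow:
  assumes "g \<in> carrier G" "\<one> < g" "h \<in> centraliser G g"
  shows "\<exists>n::nat. h \<le> g [^] n"
proof (rule ccontr)
  assume "\<not> ?thesis"
  then have *: "\<forall>n::nat. g [^] n < h" by (simp add: not_le)
  from *[rule_format, of 0] have "\<one> < h" by simp
  with steep[of h g] * assms show False by (auto simp: centraliser_def)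
qed

text \<open>One direction replaces centraliser bounds by powers, the other uses that
  \<open>\<one>\<close> and the powers of \<open>g\<close> centralise \<open>g\<close>. With
  centralisers gone, subgroups, conjugation and retractions can all be treated through this
  description.\<close>

lemma preceq_iff_pow:
  assumes [simp]: "f \<in> carrier G" "g \<in> carrier G"
  shows "f \<preceq> g \<longleftrightarrow> (\<exists>n::nat. group_abs f \<le> group_abs g [^] n)"
proof -
  let ?f = "group_abs f" and ?g = "group_abs g"
  have "?f \<preceq> ?g \<longleftrightarrow> (\<exists>n::nat. ?f \<le> ?g [^] n)"
  proof
    assume L: "?f \<preceq> ?g"
    show "\<exists>n::nat. ?f \<le> ?g [^] n"
    proof (cases "?f = \<one>")
      case True
      then show ?thesis using one_le_pow[of ?g] one_le_group_abs[of g] by (metis assms(2) group_abs_closed)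
    next
      case False
      with L obtain b where "?g \<noteq> \<one>" "b \<in> centraliser G ?g" "?f \<le> b"
        by (auto simp: gr_preceq_def)
      moreover obtain n :: nat where "b \<le> ?g [^] n"
        using centraliser_le_pow[of ?g b] calculation one_le_group_abs[of g]
        by (metis assms(2) group_abs_closed order_less_le)
      ultimately show ?thesis by (meson order_trans)
    qed
  next
    assume "\<exists>n::nat. ?f \<le> ?g [^] n"
    then obtain n :: nat where n: "?f \<le> ?g [^] n" ..
    have 1: "\<one> \<le> ?f" by (rule one_le_group_abs) simp
    have "\<one> \<in> centraliser G ?g" by (simp add: centraliser_def)
    moreover have "?f = \<one>" if "?g = \<one>" using n 1 that by simp
    ultimately show "?f \<preceq> ?g"
      using n 1 pow_centraliser[OF group_abs_closed[OF assms(2)], of n]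
      unfolding gr_preceq_def by blast
  qed
  then show ?thesis using preceq_group_abs[of f g] by simp
qed

lemma preceq_refl: "f \<in> carrier G \<Longrightarrow> f \<preceq> f"
  by (auto simp: preceq_iff_pow intro!: exI[of _ "1::nat"])

lemma preceq_trans:
  assumes [simp]: "f \<in> carrier G" "g \<in> carrier G" "h \<in> carrier G" and "f \<preceq> g" "g \<preceq> h"
  shows "f \<preceq> h"
proof -
  from assms obtain m n :: nat where mn: "group_abs f \<le> group_abs g [^] n" "group_abs g \<le> group_abs h [^] m"
    by (auto simp: preceq_iff_pow)
  have "group_abs g [^] n \<le> (group_abs h [^] m) [^] n"
    using mn by (intro pow_mono_base) auto
  then show ?thesis using mn by (auto simp: preceq_iff_pow nat_pow_pow intro: order_trans)
qed

text \<open>Two elements \<open>f\<close> and \<open>h\<close> of the centraliser of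
  \<open>g\<close> are not known to commute, so the comparison goes through \<open>g\<close>:
  \<open>f\<close> is below a power of the absolute value of \<open>g\<close>, which commutes with
  \<open>h\<close> and so is below a power of \<open>h\<close>.\<close>

lemma archimedean_centralisers: "archimedean_centralisers G"
  unfolding archimedean_centralisers_def
proof (intro ballI impI)
  fix g assume g [simp]: "g \<in> carrier G" and g1: "g \<noteq> \<one>"
  have sub: "subgroup (centraliser G g) G" by (rule centraliser_subgroup) simp
  interpret C: ordered_group "G\<lparr>carrier := centraliser G g\<rparr>"
    using sub by (rule ordered_group_subgroup)
  let ?g = "group_abs g"
  have g1': "\<one> < ?g" using one_le_group_abs[of g] g1 by (metis g group_abs_eq_one_iff order_less_le)
  have C: "centraliser G ?g = centraliser G g"
    by (simp add: group_abs_def centraliser_inv)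
  show "archimedean_group (G\<lparr>carrier := centraliser G g\<rparr>)"
  proof (unfold_locales, simp add: nat_pow_consistent[symmetric])
    fix f h assume fh: "f \<in> centraliser G g" "h \<in> centraliser G g" and h1: "\<one> < h"
    then have [simp]: "f \<in> carrier G" "h \<in> carrier G" by (auto simp: centraliser_def)
    obtain n :: nat where n: "f \<le> ?g [^] n"
      using centraliser_le_pow[OF group_abs_closed[OF g] g1'] fh(1) unfolding C by blast
    have "?g \<in> centraliser G h"
      using fh(2) unfolding C[symmetric] by (rule centraliser_sym) simp
    then obtain m :: nat where m: "?g \<le> h [^] m"
      using centraliser_le_pow[OF \<open>h \<in> carrier G\<close> h1] by blast
    have "?g [^] n \<le> (h [^] m) [^] n" using m by (intro pow_mono_base) auto
    then show "\<exists>n::nat. f \<le> h [^] n" using n by (auto simp: nat_pow_pow intro: order_trans)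
  qed
qed

text \<open>GOG1 holds because powers are monotone in the base, and GOG2 because an element above
  the centraliser of \<open>g\<close> is above the powers of \<open>g\<close>; this leaves
  GOG3.\<close>

lemma growth_order_groupI:
  assumes "\<And>f. \<lbrakk>f \<in> carrier G; f \<noteq> \<one>\<rbrakk> \<Longrightarrow> \<exists>s. scaling G s \<and> s \<asymp> f"
  shows "growth_order_group G"
proof
  fix f g g0 assume a: "f \<in> carrier G" "g \<in> carrier G" "\<one> < f" "\<one> < g" "g \<le> f" "g0 \<in> centraliser G g"
  then obtain n :: nat where "g0 \<le> g [^] n" using centraliser_le_pow by blast
  also have "\<dots> \<le> f [^] n" using a by (intro pow_mono_base) auto
  finally show "\<exists>f0\<in>centraliser G f. g0 \<le> f0" using pow_centraliser a by blast
next
  fix f g assume a: "f \<in> carrier G" "g \<in> carrier G" "\<one> < f" "\<one> < g" "\<forall>h\<in>centraliser G g. h < f"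
  then show "g \<otimes> f < f \<otimes> g" using pow_centraliser by (intro steep) auto
qed (use assms in auto)

lemma steep_group_subgroup:
  assumes "subgroup H G"
  shows "steep_group (G\<lparr>carrier := H\<rparr>)"
proof -
  interpret H: ordered_group "G\<lparr>carrier := H\<rparr>" using assms by (rule ordered_group_subgroup)
  have "H \<subseteq> carrier G" using assms by (rule subgroup.subset)
  then show ?thesis
    by unfold_locales (auto intro!: steep simp: subset_eq nat_pow_consistent[symmetric])
qed

text \<open>Centralisers shrink in a subgroup, so fewer pairs might be related there; the
  description by powers rules this out.\<close>

lemma preceq_subgroup:
  assumes H: "subgroup H G" and f: "f \<in> H" and g: "g \<in> H"
  shows "f \<preceq>\<^bsub>G\<lparr>carrier := H\<rparr>\<^esub> g \<longleftrightarrow> f \<preceq> g"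
proof -
  interpret H: steep_group "G\<lparr>carrier := H\<rparr>" using H by (rule steep_group_subgroup)
  have fg: "f \<in> carrier G" "g \<in> carrier G" using assms subgroup.subset by blast+
  have abs: "H.group_abs h = group_abs h" if "h \<in> H" for h
    using that H by (auto simp: H.group_abs_def group_abs_def m_inv_consistent)
  show ?thesis
    using f g fg by (simp add: preceq_iff_pow H.preceq_iff_pow abs nat_pow_consistent[symmetric])
qed

end

text \<open>In an Archimedean centraliser the powers of \<open>g\<close> are cofinal, so an
  \<open>f\<close> above all of them is above the whole centraliser and GOG2 applies.\<close>

lemma steep_groupI:
  assumes "growth_order_group G" "archimedean_centralisers G"
  shows "steep_group G"
proof -
  interpret growth_order_group G by fact
  show ?thesis
  proof
    fix f g assume a: "f \<in> carrier G" "g \<in> carrier G" "\<one>\<^bsub>G\<^esub> < f" "\<one>\<^bsub>G\<^esub> < g" "\<forall>n::nat. g [^]\<^bsub>G\<^esub> n < f"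
    have "archimedean_group (G\<lparr>carrier := centraliser G g\<rparr>)"
      using a assms by (auto simp: archimedean_centralisers_def)
    then interpret C: archimedean_group "G\<lparr>carrier := centraliser G g\<rparr>" .
    have "h < f" if "h \<in> centraliser G g" for h
      using C.archimedean[of h g] that a centraliser_self[of g]
      by (auto simp: nat_pow_consistent[symmetric] intro: le_less_trans)
    then show "g \<otimes>\<^bsub>G\<^esub> f < f \<otimes>\<^bsub>G\<^esub> g" using a by (intro GOG2) auto
  qed
qed

section \<open>Conjugation, scaling elements and convex subgroups\<close>

context ordered_group
begin

definition conj_by :: "'a \<Rightarrow> 'a \<Rightarrow> 'a" where "conj_by b f = b \<otimes> f \<otimes> inv b"

context
  fixes b assumes b [simp]: "b \<in> carrier G"
begin

lemma conj_by_closed [simp]: "f \<in> carrier G \<Longrightarrow> conj_by b f \<in> carrier G"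
  by (simp add: conj_by_def)

lemma conj_by_one [simp]: "conj_by b \<one> = \<one>"
  by (simp add: conj_by_def)

lemma conj_by_mult:
  assumes [simp]: "f \<in> carrier G" "g \<in> carrier G"
  shows "conj_by b (f \<otimes> g) = conj_by b f \<otimes> conj_by b g"
proof -
  have "inv b \<otimes> (b \<otimes> (g \<otimes> inv b)) = g \<otimes> inv b"
    by (simp add: m_assoc[symmetric])
  then show ?thesis by (simp add: conj_by_def m_assoc)
qed

lemma conj_by_inv: "f \<in> carrier G \<Longrightarrow> conj_by b (inv f) = inv (conj_by b f)"
  by (simp add: conj_by_def inv_mult_group m_assoc)

lemma conj_by_pow: "f \<in> carrier G \<Longrightarrow> conj_by b (f [^] (n::nat)) = conj_by b f [^] n"
  by (induction n) (simp_all add: conj_by_mult)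

lemma conj_by_less_iff:
  "\<lbrakk>f \<in> carrier G; g \<in> carrier G\<rbrakk> \<Longrightarrow> conj_by b f < conj_by b g \<longleftrightarrow> f < g"
  by (simp add: conj_by_def mult_less_left_iff mult_less_right_iff)

lemma conj_by_eq_iff:
  "\<lbrakk>f \<in> carrier G; g \<in> carrier G\<rbrakk> \<Longrightarrow> conj_by b f = conj_by b g \<longleftrightarrow> f = g"
  by (simp add: conj_by_def)

lemma conj_by_inv_conj_by: "f \<in> carrier G \<Longrightarrow> conj_by b (conj_by (inv b) f) = f"
  by (simp add: conj_by_def m_assoc) (simp add: m_assoc[symmetric])

lemma conj_by_group_abs: "f \<in> carrier G \<Longrightarrow> group_abs (conj_by b f) = conj_by b (group_abs f)"
  using conj_by_less_iff[of f \<one>] by (auto simp: group_abs_def conj_by_inv)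

end

lemma conj_by_conj_by:
  "\<lbrakk>a \<in> carrier G; b \<in> carrier G; f \<in> carrier G\<rbrakk> \<Longrightarrow> conj_by a (conj_by b f) = conj_by (a \<otimes> b) f"
  by (simp add: conj_by_def inv_mult_group m_assoc)

lemma conj_by_inv_eq_iff:
  assumes "b \<in> carrier G" "f \<in> carrier G" "g \<in> carrier G"
  shows "conj_by (inv b) f = g \<longleftrightarrow> f = conj_by b g"
  using assms conj_by_inv_conj_by[of b f] conj_by_inv_conj_by[of "inv b" g] by auto

end

context steep_group
begin

lemma preceq_conj_by:
  "\<lbrakk>b \<in> carrier G; f \<in> carrier G; g \<in> carrier G\<rbrakk> \<Longrightarrow> conj_by b f \<preceq> conj_by b g \<longleftrightarrow> f \<preceq> g"
  by (simp add: preceq_iff_pow conj_by_group_abs conj_by_pow[symmetric] conj_by_less_iff not_less[symmetric])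

text \<open>Conjugation is an automorphism of the ordered group, so it carries centralisers onto
  centralisers and preserves the relations involved. This spreads one scaling element over its
  conjugacy class.\<close>

lemma scaling_conj_by:
  assumes b [simp]: "b \<in> carrier G" and s: "scaling G s"
  shows "scaling G (conj_by b s)"
proof -
  have sc [simp]: "s \<in> carrier G" and s1: "\<one> < s"
    and comm: "comm_group (G\<lparr>carrier := centraliser G s\<rparr>)"
    and sim: "\<And>f. \<lbrakk>f \<in> carrier G; f \<asymp> s\<rbrakk> \<Longrightarrow> \<exists>g\<in>centraliser G s - {\<one>}. g \<sim> f"
    using s by (auto simp: scaling_def)
  let ?b = "conj_by b"
  have cent: "h \<in> centraliser G (?b s) \<longleftrightarrow> (\<exists>k\<in>centraliser G s. h = ?b k)" for h
  proof
    assume h: "h \<in> centraliser G (?b s)"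
    then have [simp]: "h \<in> carrier G" by (simp add: centraliser_def)
    define k where "k = conj_by (inv b) h"
    have [simp]: "k \<in> carrier G" and hk: "h = ?b k" by (simp_all add: k_def conj_by_inv_conj_by)
    from h show "\<exists>k\<in>centraliser G s. h = ?b k"
      by (intro bexI[of _ k]) (auto simp: hk centraliser_def conj_by_mult[symmetric] conj_by_eq_iff)
  qed (auto simp: centraliser_def conj_by_mult[symmetric] conj_by_eq_iff)
  have sub: "subgroup (centraliser G (?b s)) G" by (rule centraliser_subgroup) simp
  show ?thesis
    unfolding scaling_def
  proof (intro conjI ballI impI)
    show "\<one> < ?b s" using conj_by_less_iff[of b \<one> s] s1 by simp
    show "comm_group (G\<lparr>carrier := centraliser G (?b s)\<rparr>)"
    proof (rule group.group_comm_groupI)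
      show "group (G\<lparr>carrier := centraliser G (?b s)\<rparr>)" using sub by (rule subgroup_imp_group)
      fix h k assume "h \<in> carrier (G\<lparr>carrier := centraliser G (?b s)\<rparr>)"
        "k \<in> carrier (G\<lparr>carrier := centraliser G (?b s)\<rparr>)"
      then obtain h' k' where hk: "h' \<in> centraliser G s" "k' \<in> centraliser G s" "h = ?b h'" "k = ?b k'"
        by (auto simp: cent)
      then have "h' \<otimes> k' = k' \<otimes> h'"
        using comm_groupE(4)[OF comm] by auto
      then show "h \<otimes>\<^bsub>G\<lparr>carrier := centraliser G (?b s)\<rparr>\<^esub> k = k \<otimes>\<^bsub>G\<lparr>carrier := centraliser G (?b s)\<rparr>\<^esub> h"
        using hk by (auto simp: centraliser_def conj_by_mult[symmetric])
    qed
    fix f assume f [simp]: "f \<in> carrier G" and fs: "f \<asymp> ?b s"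
    define k where "k = conj_by (inv b) f"
    have [simp]: "k \<in> carrier G" and fk: "f = ?b k" by (simp_all add: k_def conj_by_inv_conj_by)
    have "k \<asymp> s" using fs by (simp add: fk gr_asymp_def preceq_conj_by)
    then obtain g where g: "g \<in> centraliser G s" "g \<noteq> \<one>" "g \<sim> k" using sim[of k] by auto
    then have [simp]: "g \<in> carrier G" by (simp add: centraliser_def)
    have "?b g \<noteq> \<one>" using g conj_by_eq_iff[of b g \<one>] by auto
    moreover have "?b g \<sim> f"
      using g(3) conj_by_eq_iff[of b k \<one>] \<open>?b g \<noteq> \<one>\<close>
      by (simp add: fk gr_sim_def gr_prec_def conj_by_inv[symmetric] conj_by_mult[symmetric] preceq_conj_by)
    ultimately show "\<exists>g\<in>centraliser G (?b s) - {\<one>}. g \<sim> f" using g(1) cent by blast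
  qed simp
qed

lemma convex_subgroup_preceq_closed:
  assumes N: "subgroup N G" "convex_in (carrier G) N" and f: "f \<in> N" and g: "g \<in> carrier G" "g \<preceq> f"
  shows "g \<in> N"
proof -
  interpret N: subgroup N G by fact
  have fc [simp]: "f \<in> carrier G" using f by simp
  obtain n :: nat where n: "group_abs g \<le> group_abs f [^] n" using g by (auto simp: preceq_iff_pow)
  have "group_abs f \<in> N" using f by (auto simp: group_abs_def)
  then have "group_abs f [^] n \<in> N" by (induction n) auto
  then have "group_abs g \<in> N"
    using N(2) n one_le_group_abs[of g] g(1) N.one_closed unfolding convex_in_def
    by (meson group_abs_closed)
  then show ?thesis
    using g(1) N.m_inv_closed[of "inv g"] by (auto simp: group_abs_def split: if_splits)
qed

text \<open>Whatever \<open>s\<close> dominates lies in \<open>N\<close>, in particular its whole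
  centraliser; so passing to \<open>N\<close> changes neither the centraliser nor the approximations
  found in it.\<close>

lemma scaling_subgroup:
  assumes N: "subgroup N G" and closed: "\<And>g. g \<in> carrier G \<Longrightarrow> g \<preceq> s \<Longrightarrow> g \<in> N"
    and s: "scaling G s"
  shows "scaling (G\<lparr>carrier := N\<rparr>) s"
proof -
  interpret N: subgroup N G by fact
  have sc [simp]: "s \<in> carrier G" and s1: "\<one> < s"
    and comm: "comm_group (G\<lparr>carrier := centraliser G s\<rparr>)"
    and sim: "\<And>f. \<lbrakk>f \<in> carrier G; f \<asymp> s\<rbrakk> \<Longrightarrow> \<exists>g\<in>centraliser G s - {\<one>}. g \<sim> f"
    using s by (auto simp: scaling_def)
  have sN: "s \<in> N" by (rule closed) (simp_all add: preceq_refl)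
  have CN: "h \<in> N" if "h \<in> centraliser G s" for h
  proof (rule closed)
    show "h \<in> carrier G" using that by (simp add: centraliser_def)
    show "h \<preceq> s" using that s1 unfolding gr_preceq_def by auto
  qed
  have C: "centraliser (G\<lparr>carrier := N\<rparr>) s = centraliser G s"
    using CN by (auto simp: centraliser_def)
  have "\<exists>g\<in>centraliser G s - {\<one>}. g \<sim>\<^bsub>G\<lparr>carrier := N\<rparr>\<^esub> f"
    if f: "f \<in> N" "f \<asymp>\<^bsub>G\<lparr>carrier := N\<rparr>\<^esub> s" for f
  proof -
    have "f \<asymp> s" using f sN by (simp add: gr_asymp_def preceq_subgroup[OF N])
    then obtain g where g: "g \<in> centraliser G s" "g \<noteq> \<one>" "g \<sim> f" using sim[of f] f by auto
    then have "g \<in> N" using CN by blast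
    with g f have "g \<sim>\<^bsub>G\<lparr>carrier := N\<rparr>\<^esub> f"
      using N by (simp add: gr_sim_def gr_prec_def preceq_subgroup[OF N] m_inv_consistent)
    with g show ?thesis by blast
  qed
  then show ?thesis using sN s1 comm by (simp add: scaling_def C)
qed

lemma growth_order_group_convex_subgroup:
  assumes N: "subgroup N G" "convex_in (carrier G) N"
    and sc: "\<And>f. f \<in> N \<Longrightarrow> f \<noteq> \<one> \<Longrightarrow> \<exists>s. scaling G s \<and> s \<asymp> f"
  shows "growth_order_group (G\<lparr>carrier := N\<rparr>)"
proof -
  interpret N: subgroup N G by fact
  interpret S: steep_group "G\<lparr>carrier := N\<rparr>" using N(1) by (rule steep_group_subgroup)
  show ?thesis
  proof (rule S.growth_order_groupI)
    fix f assume "f \<in> carrier (G\<lparr>carrier := N\<rparr>)" "f \<noteq> \<one>\<^bsub>G\<lparr>carrier := N\<rparr>\<^esub>"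
    then have f: "f \<in> N" "f \<noteq> \<one>" by auto
    then obtain s where s: "scaling G s" "s \<asymp> f" using sc by blast
    have sc: "s \<in> carrier G" using s by (simp add: scaling_def)
    have sN: "s \<in> N"
      using convex_subgroup_preceq_closed[OF N f(1) sc] s(2) by (simp add: gr_asymp_def)
    have "scaling (G\<lparr>carrier := N\<rparr>) s"
      using N(1) convex_subgroup_preceq_closed[OF N sN] s(1) by (rule scaling_subgroup)
    moreover have "s \<asymp>\<^bsub>G\<lparr>carrier := N\<rparr>\<^esub> f"
      using s(2) sN f(1) by (simp add: gr_asymp_def preceq_subgroup[OF N(1)])
    ultimately show "\<exists>s. scaling (G\<lparr>carrier := N\<rparr>) s \<and> s \<asymp>\<^bsub>G\<lparr>carrier := N\<rparr>\<^esub> f" by blast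
  qed
qed

end

section \<open>Monotone retractions\<close>

locale monotone_retraction = ordered_group G
  for G :: "('a::linorder, 'b) monoid_scheme" (structure) +
  fixes H :: "'a set" and pr :: "'a \<Rightarrow> 'a"
  assumes subgroup_H: "subgroup H G"
    and pr_mult: "\<lbrakk>f \<in> carrier G; g \<in> carrier G\<rbrakk> \<Longrightarrow> pr (f \<otimes> g) = pr f \<otimes> pr g"
    and pr_in: "f \<in> carrier G \<Longrightarrow> pr f \<in> H"
    and pr_id: "h \<in> H \<Longrightarrow> pr h = h"
    and pr_mono: "\<lbrakk>f \<in> carrier G; g \<in> carrier G; f \<le> g\<rbrakk> \<Longrightarrow> pr f \<le> pr g"
begin

sublocale H: subgroup H G by (rule subgroup_H)

lemma pr_closed [simp]: "f \<in> carrier G \<Longrightarrow> pr f \<in> carrier G"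
  using pr_in H.subset by blast

lemma pr_one [simp]: "pr \<one> = \<one>"
  by (simp add: pr_id)

lemma pr_inv:
  assumes [simp]: "f \<in> carrier G"
  shows "pr (inv f) = inv (pr f)"
  by (rule inv_equality[symmetric]) (simp_all add: pr_mult[symmetric])

lemma pr_pow: "f \<in> carrier G \<Longrightarrow> pr (f [^] (n::nat)) = pr f [^] n"
  by (induction n) (simp_all add: pr_mult)

lemma less_if_pr_less: "\<lbrakk>f \<in> carrier G; g \<in> carrier G; pr f < pr g\<rbrakk> \<Longrightarrow> f < g"
  using pr_mono[of g f] by (auto simp: not_less[symmetric])

lemma steep_extension:
  assumes "steep_group (G\<lparr>carrier := H\<rparr>)"
    and kernel: "\<And>f g. \<lbrakk>f \<in> carrier G; g \<in> carrier G; \<one> < f; \<one> < g; pr g = \<one>; \<forall>n::nat. g [^] n < f\<rbrakk>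
      \<Longrightarrow> g \<otimes> f < f \<otimes> g"
  shows "steep_group G"
proof
  interpret S: steep_group "G\<lparr>carrier := H\<rparr>" by fact
  fix f g assume a: "f \<in> carrier G" "g \<in> carrier G" "\<one> < f" "\<one> < g" "\<forall>n::nat. g [^] n < f"
  show "g \<otimes> f < f \<otimes> g"
  proof (cases "pr g = \<one>")
    case False
    have le: "pr g [^] n \<le> pr f" for n :: nat
      using pr_mono[of "g [^] n" f] a by (simp add: pr_pow less_imp_le)
    have g1: "\<one> < pr g" using pr_mono[of \<one> g] a False by (simp add: order_less_le)
    \<comment> \<open>Projection preserves only \<open>\<le>\<close>; the bound at exponent
      \<open>Suc n\<close> together with \<open>\<one> < pr g\<close> restores strictness at
      \<open>n\<close>.\<close>
    then have lt: "pr g [^] n < pr f" for n :: nat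
      using pow_less_pow_Suc[of "pr g" n] le[of "Suc n"] a(2) by simp
    from this[of 0] have "\<one> < pr f" by simp
    with S.steep[of "pr f" "pr g"] a g1 lt
    have "pr (g \<otimes> f) < pr (f \<otimes> g)"
      by (simp add: pr_in pr_mult nat_pow_consistent[symmetric])
    then show ?thesis by (rule less_if_pr_less[rotated 2]) (simp_all add: a)
  next
    case True
    with a show ?thesis by (intro kernel)
  qed
qed

lemma pr_group_abs:
  assumes "f \<in> carrier G"
  shows "group_abs (pr f) = pr (group_abs f)"
  using assms pr_mono[of f \<one>] pr_mono[of \<one> f]
  by (auto simp: group_abs_def pr_inv not_less)

text \<open>The centraliser of \<open>s\<close> meets the kernel of \<open>pr\<close> trivially, so
  it embeds in the Abelian centraliser taken in \<open>H\<close>. An approximation of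
  \<open>pr f\<close> found in \<open>H\<close> also approximates \<open>f\<close>, because
  comparisons with an element of nontrivial image lift.\<close>

lemma scaling_extension:
  assumes "steep_group G" and s: "scaling (G\<lparr>carrier := H\<rparr>) s"
  shows "scaling G s" and "\<And>f. f \<in> carrier G \<Longrightarrow> s \<asymp>\<^bsub>G\<lparr>carrier := H\<rparr>\<^esub> pr f \<Longrightarrow> s \<asymp> f"
proof -
  interpret steep_group G by fact
  let ?H = "G\<lparr>carrier := H\<rparr>"
  have sH: "s \<in> H" and s1: "\<one> < s"
    and comm: "comm_group (G\<lparr>carrier := centraliser ?H s\<rparr>)"
    and sim: "\<And>f. \<lbrakk>f \<in> H; f \<asymp>\<^bsub>?H\<^esub> s\<rbrakk> \<Longrightarrow> \<exists>g\<in>centraliser ?H s - {\<one>}. g \<sim>\<^bsub>?H\<^esub> f"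
    using s by (auto simp: scaling_def)
  have sc [simp]: "s \<in> carrier G" using sH by simp
  have pr_imp: "pr f \<preceq> pr g" if "f \<preceq> g" "f \<in> carrier G" "g \<in> carrier G" for f g
  proof -
    from that obtain n :: nat where "group_abs f \<le> group_abs g [^] n" by (auto simp: preceq_iff_pow)
    then have "pr (group_abs f) \<le> pr (group_abs g [^] n)" using that by (intro pr_mono) auto
    then show ?thesis using that by (auto simp: preceq_iff_pow pr_group_abs pr_pow)
  qed
  \<comment> \<open>As \<open>pr g \<noteq> \<one>\<close>, one extra factor makes the projected
    inequality strict, and strict inequalities lift through a monotone map.\<close>
  have imp_pr: "f \<preceq> g" if "pr f \<preceq> pr g" "pr g \<noteq> \<one>" and [simp]: "f \<in> carrier G" "g \<in> carrier G" for f g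
  proof -
    have "\<one> < group_abs (pr g)"
      using that one_le_group_abs[of "pr g"] by (metis group_abs_eq_one_iff order_less_le pr_closed)
    moreover from that obtain n :: nat where "group_abs (pr f) \<le> group_abs (pr g) [^] n"
      by (auto simp: preceq_iff_pow)
    ultimately have "group_abs (pr f) < group_abs (pr g) [^] Suc n"
      using pow_less_pow_Suc[of "group_abs (pr g)" n] by simp
    then have "group_abs f < group_abs g [^] Suc n"
      using pr_pow[of "group_abs g" "Suc n"] less_if_pr_less[of "group_abs f" "group_abs g [^] Suc n"]
      by (simp add: pr_group_abs del: nat_pow_Suc)
    then show ?thesis unfolding preceq_iff_pow[OF that(3,4)] by (blast intro: less_imp_le)
  qed
  have not_one: "pr f \<noteq> \<one>" if "s \<preceq> f" "f \<in> carrier G" for f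
    using pr_imp[OF that(1)] that(2) s1 by (auto simp: pr_id[OF sH] gr_preceq_def)
  show asymp: "s \<asymp> f" if "f \<in> carrier G" "s \<asymp>\<^bsub>?H\<^esub> pr f" for f
  proof -
    have *: "pr s \<preceq> pr f" "pr f \<preceq> pr s"
      using that sH by (auto simp: gr_asymp_def preceq_subgroup[OF subgroup_H] pr_id pr_in)
    then have "pr f \<noteq> \<one>" using s1 by (auto simp: pr_id[OF sH] gr_preceq_def)
    with * show ?thesis using imp_pr[of s f] imp_pr[of f s] that s1 by (auto simp: gr_asymp_def pr_id[OF sH])
  qed
  have CH: "pr h \<in> centraliser ?H s" if "h \<in> centraliser G s" for h
    using that pr_mult[of s h] pr_mult[of h s] by (auto simp: centraliser_def pr_in pr_id[OF sH])
  have sub: "subgroup (centraliser G s) G" by (rule centraliser_subgroup) simp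
  interpret C: subgroup "centraliser G s" G by (rule sub)
  \<comment> \<open>A nontrivial \<open>h\<close> commuting with \<open>s\<close> satisfies
    \<open>s \<preceq> h\<close>, as \<open>s\<close> itself is a bound taken from the centraliser
    of \<open>h\<close>; such an \<open>h\<close> cannot project to \<open>\<one>\<close>.\<close>
  have pr_inj: "h = \<one>" if h: "h \<in> centraliser G s" "pr h = \<one>" for h
  proof (rule ccontr)
    assume "h \<noteq> \<one>"
    then have "s \<preceq> h"
      using centraliser_sym[OF h(1)] by (auto simp: gr_preceq_def)
    then show False using not_one[of h] h by auto
  qed
  show "scaling G s"
    unfolding scaling_def
  proof (intro conjI ballI impI)
    show "comm_group (G\<lparr>carrier := centraliser G s\<rparr>)"
    proof (rule group.group_comm_groupI)
      show "group (G\<lparr>carrier := centraliser G s\<rparr>)" using sub by (rule subgroup_imp_group)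
      fix h k assume "h \<in> carrier (G\<lparr>carrier := centraliser G s\<rparr>)"
        "k \<in> carrier (G\<lparr>carrier := centraliser G s\<rparr>)"
      then have hk: "h \<in> centraliser G s" "k \<in> centraliser G s" by auto
      then have [simp]: "h \<in> carrier G" "k \<in> carrier G" by auto
      have "pr h \<otimes> pr k = pr k \<otimes> pr h"
        using comm_groupE(4)[OF comm] CH hk by auto
      then have "pr (h \<otimes> k \<otimes> inv (k \<otimes> h)) = \<one>"
        by (simp add: pr_mult pr_inv inv_mult_group[symmetric] del: inv_mult_group)
      moreover have "h \<otimes> k \<otimes> inv (k \<otimes> h) \<in> centraliser G s" using hk by auto
      ultimately have "h \<otimes> k \<otimes> inv (k \<otimes> h) = \<one>" by (rule pr_inj[rotated])
      then have "h \<otimes> k = k \<otimes> h" using inv_solve_right[of "\<one>" "h \<otimes> k" "k \<otimes> h"] by auto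
      then show "h \<otimes>\<^bsub>G\<lparr>carrier := centraliser G s\<rparr>\<^esub> k = k \<otimes>\<^bsub>G\<lparr>carrier := centraliser G s\<rparr>\<^esub> h"
        by simp
    qed
    fix f assume f [simp]: "f \<in> carrier G" and fs: "f \<asymp> s"
    have pr_f: "pr f \<noteq> \<one>" using not_one[of f] fs by (simp add: gr_asymp_def)
    have "pr f \<asymp>\<^bsub>?H\<^esub> s"
      using fs pr_imp[of f s] pr_imp[of s f] sH
      by (simp add: gr_asymp_def preceq_subgroup[OF subgroup_H] pr_in pr_id)
    then obtain g where g: "g \<in> centraliser ?H s" "g \<noteq> \<one>" "g \<sim>\<^bsub>?H\<^esub> pr f"
      using sim[of "pr f"] pr_in by auto
    then have gH: "g \<in> H" by (simp add: centraliser_def)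
    then have [simp]: "g \<in> carrier G" by simp
    have "g \<otimes> inv (pr f) \<prec> g"
      using g(3) gH pr_in[OF f]
      by (simp add: gr_sim_def gr_prec_def preceq_subgroup[OF subgroup_H] m_inv_consistent[OF subgroup_H])
    then have "pr (g \<otimes> inv f) \<prec> pr g" by (simp add: pr_mult pr_inv pr_id[OF gH])
    then have "g \<otimes> inv f \<prec> g"
      using imp_pr[of "g \<otimes> inv f" g] pr_imp[of g "g \<otimes> inv f"] g(2)
      by (auto simp: gr_prec_def pr_id[OF gH])
    moreover have "f \<noteq> \<one>" using pr_f by auto
    ultimately have "g \<sim> f" using g(2) unfolding gr_sim_def by blast
    moreover have "g \<in> centraliser G s" using g(1) H.subset unfolding centraliser_def by auto
    ultimately show "\<exists>g\<in>centraliser G s - {\<one>}. g \<sim> f" using g(2) by blast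
  qed (use s1 in auto)
qed

end

text \<open>The map reads off the second factor of \<open>n \<otimes> h\<close>, which is unique
  because \<open>N\<close> and \<open>H\<close> meet trivially. Normality makes it multiplicative,
  convexity makes it monotone.\<close>

lemma (in ordered_group) monotone_retraction_of_complement:
  assumes "normal N G" and conv: "convex_in (carrier G) N" and compl: "complement_in G N H"
  obtains pr where "monotone_retraction G H pr" "\<And>f. f \<in> carrier G \<Longrightarrow> pr f = \<one> \<longleftrightarrow> f \<in> N"
proof -
  interpret N: normal N G by fact
  have H: "subgroup H G" and NH: "N \<inter> H = {\<one>}" and prod: "N <#> H = carrier G"
    using compl by (auto simp: complement_in_def)
  interpret H: subgroup H G by (rule H)
  have uniq: "h = h'" if "n \<in> N" "n' \<in> N" "h \<in> H" "h' \<in> H" "n \<otimes> h = n' \<otimes> h'" for n n' h h'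
  proof -
    have [simp]: "n \<in> carrier G" "n' \<in> carrier G" "h \<in> carrier G" "h' \<in> carrier G"
      using that by auto
    have "inv n' \<otimes> n \<otimes> h = h'"
      using that(5) inv_solve_left'[of h' n' "n \<otimes> h"] by (simp add: m_assoc)
    then have "inv n' \<otimes> n = h' \<otimes> inv h"
      by (simp add: inv_solve_right)
    moreover have "inv n' \<otimes> n \<in> N" "h' \<otimes> inv h \<in> H" using that by auto
    ultimately have "h' \<otimes> inv h = \<one>" using NH by auto
    then show ?thesis by (metis inv_solve_right \<open>h \<in> carrier G\<close> \<open>h' \<in> carrier G\<close> l_one one_closed)
  qed
  define pr where "pr f = (THE h. h \<in> H \<and> (\<exists>n\<in>N. f = n \<otimes> h))" for f
  have pr_eq: "pr (n \<otimes> h) = h" if "n \<in> N" "h \<in> H" for n h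
    unfolding pr_def using that uniq by (intro the_equality) blast+
  have decomp: "\<exists>n\<in>N. \<exists>h\<in>H. f = n \<otimes> h" if "f \<in> carrier G" for f
    using that unfolding prod[symmetric] set_mult_def by blast
  have mult: "pr (f \<otimes> g) = pr f \<otimes> pr g" if fg: "f \<in> carrier G" "g \<in> carrier G" for f g
  proof -
    obtain n h n' h' where nh: "n \<in> N" "h \<in> H" "f = n \<otimes> h" "n' \<in> N" "h' \<in> H" "g = n' \<otimes> h'"
      using decomp fg by meson
    then have [simp]: "n \<in> carrier G" "n' \<in> carrier G" "h \<in> carrier G" "h' \<in> carrier G" by auto
    have "h \<otimes> n' \<otimes> inv h \<in> N" using nh by (intro N.inv_op_closed2) auto
    then have N: "n \<otimes> (h \<otimes> n' \<otimes> inv h) \<in> N" using nh by auto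
    have "inv h \<otimes> (h \<otimes> h') = h'" by (simp add: m_assoc[symmetric])
    then have "f \<otimes> g = n \<otimes> (h \<otimes> n' \<otimes> inv h) \<otimes> (h \<otimes> h')" by (simp add: nh m_assoc)
    then have "pr (f \<otimes> g) = h \<otimes> h'" using pr_eq[OF N, of "h \<otimes> h'"] nh by auto
    then show ?thesis using nh pr_eq by simp
  qed
  have id: "pr h = h" if "h \<in> H" for h using pr_eq[of \<one> h] that by simp
  have prH: "pr f \<in> H" if "f \<in> carrier G" for f
    using decomp[OF that] pr_eq by auto
  \<comment> \<open>If \<open>\<one> \<le> n \<otimes> h\<close> with \<open>h < \<one>\<close>,
    then \<open>inv h\<close> lies between \<open>\<one>\<close> and \<open>n\<close>, and convexity
    would put it in \<open>N\<close>.\<close>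
  have nonneg: "\<one> \<le> pr k" if k: "k \<in> carrier G" "\<one> \<le> k" for k
  proof (rule ccontr)
    assume neg: "\<not> \<one> \<le> pr k"
    obtain n h where nh: "n \<in> N" "h \<in> H" "k = n \<otimes> h" using decomp k by meson
    then have c [simp]: "n \<in> carrier G" "h \<in> carrier G" by auto
    have h: "h < \<one>" using neg nh pr_eq by (simp add: not_le)
    then have "\<one> < inv h" using inv_less_iff[of h \<one>] by simp
    moreover have "inv h \<le> n"
      using k(2) nh mult_le_right[of "inv h" "n \<otimes> h" \<one>] by (simp add: m_assoc)
    ultimately have "inv h \<in> N"
      using conv nh(1) N.one_closed unfolding convex_in_def by (meson c inv_closed less_imp_le)
    then have "h \<in> N \<inter> H" using nh(2) N.m_inv_closed[of "inv h"] by simp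
    then show False using NH h by auto
  qed
  have mono: "pr f \<le> pr g" if fg: "f \<in> carrier G" "g \<in> carrier G" "f \<le> g" for f g
  proof -
    have 1: "\<one> \<le> inv f \<otimes> g" using mult_le_left[of "inv f" g f] fg by simp
    have c: "pr f \<in> carrier G" "pr (inv f \<otimes> g) \<in> carrier G" using prH fg by auto
    have "f \<otimes> (inv f \<otimes> g) = g" using fg by (simp add: m_assoc[symmetric])
    then have "pr g = pr f \<otimes> pr (inv f \<otimes> g)" using mult[of f "inv f \<otimes> g"] fg by simp
    then show ?thesis using mult_le_left[of "pr f" "pr (inv f \<otimes> g)" \<one>] nonneg[of "inv f \<otimes> g"] 1 c fg by simp
  qed
  have retr: "monotone_retraction G H pr"
    by unfold_locales (use mult id prH mono in \<open>auto\<close>)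
  have ker: "pr f = \<one> \<longleftrightarrow> f \<in> N" if "f \<in> carrier G" for f
  proof -
    obtain n h where nh: "n \<in> N" "h \<in> H" "f = n \<otimes> h" using decomp[OF \<open>f \<in> carrier G\<close>] by meson
    then have "pr f = h" using pr_eq by simp
    moreover have "h = \<one>" if "f \<in> N"
      using uniq[of f n \<one> h] nh that by auto
    moreover have "f \<in> N" if "h = \<one>"
      using nh that by simp
    ultimately show ?thesis by blast
  qed
  show thesis using retr ker by (rule that)
qed

section \<open>Infinitesimal, limited and infinite elements\<close>

text \<open>This and the next two notions refer only to the order, with the natural numbers as
  yardstick. Over real constants they become the maximal ideal, the valuation ring and the carrier
  of the composition group.\<close>

definition infinitesimal :: "'k::linordered_field \<Rightarrow> bool"
  where "infinitesimal a \<longleftrightarrow> (\<forall>n::nat. of_nat n * \<bar>a\<bar> < 1)"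

definition limited :: "'k::linordered_field \<Rightarrow> bool"
  where "limited a \<longleftrightarrow> (\<exists>n::nat. \<bar>a\<bar> \<le> of_nat n)"

definition pos_infinite :: "'k::linordered_field \<Rightarrow> bool"
  where "pos_infinite a \<longleftrightarrow> (\<forall>n::nat. of_nat n < a)"

lemma infinitesimal_minus [simp]: "infinitesimal (- a) \<longleftrightarrow> infinitesimal a"
  by (simp add: infinitesimal_def)

lemma infinitesimal_le:
  assumes "infinitesimal a" "\<bar>b\<bar> \<le> \<bar>a\<bar>"
  shows "infinitesimal b"
  unfolding infinitesimal_def
proof
  fix n :: nat
  have "of_nat n * \<bar>b\<bar> \<le> of_nat n * \<bar>a\<bar>" using assms(2) by (intro mult_left_mono) auto
  then show "of_nat n * \<bar>b\<bar> < 1" using assms(1) unfolding infinitesimal_def by (meson le_less_trans)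
qed

lemma infinitesimal_mult:
  assumes "infinitesimal a" "limited b"
  shows "infinitesimal (a * b)"
  unfolding infinitesimal_def
proof
  fix n :: nat
  obtain m :: nat where m: "\<bar>b\<bar> \<le> of_nat m" using assms(2) by (auto simp: limited_def)
  have "of_nat n * \<bar>a * b\<bar> \<le> of_nat n * (\<bar>a\<bar> * of_nat m)"
    using m by (simp add: abs_mult mult_left_mono)
  also have "\<dots> = of_nat (n * m) * \<bar>a\<bar>" by simp
  also have "\<dots> < 1" using assms(1) unfolding infinitesimal_def by blast
  finally show "of_nat n * \<bar>a * b\<bar> < 1" .
qed

lemma infinitesimal_mult': "limited b \<Longrightarrow> infinitesimal a \<Longrightarrow> infinitesimal (b * a)"
  using infinitesimal_mult[of a b] by (simp add: mult.commute)

lemma infinitesimal_less: "infinitesimal a \<Longrightarrow> numeral k * \<bar>a\<bar> < 1"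
  unfolding infinitesimal_def by (metis of_nat_numeral)

lemma infinitesimal_limited: "infinitesimal a \<Longrightarrow> limited a"
  unfolding infinitesimal_def limited_def by (metis less_imp_le mult_1 of_nat_1)

lemma not_infinitesimal_one: "\<not> infinitesimal 1"
  unfolding infinitesimal_def by (auto intro: exI[of _ 1])

lemma limited_le: "limited a \<Longrightarrow> \<bar>b\<bar> \<le> \<bar>a\<bar> \<Longrightarrow> limited b"
  unfolding limited_def by (meson order_trans)

lemma limited_add:
  assumes "limited a" "limited b"
  shows "limited (a + b)"
proof -
  obtain m n :: nat where "\<bar>a\<bar> \<le> of_nat m" "\<bar>b\<bar> \<le> of_nat n" using assms by (auto simp: limited_def)
  then have "\<bar>a + b\<bar> \<le> of_nat (m + n)" by simp
  then show ?thesis unfolding limited_def by blast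
qed

lemma limited_mult:
  assumes "limited a" "limited b"
  shows "limited (a * b)"
proof -
  obtain m n :: nat where "\<bar>a\<bar> \<le> of_nat m" "\<bar>b\<bar> \<le> of_nat n" using assms by (auto simp: limited_def)
  then have "\<bar>a * b\<bar> \<le> of_nat (m * n)" by (simp add: abs_mult mult_mono)
  then show ?thesis unfolding limited_def by blast
qed

lemma limited_of_nat [simp]: "limited (of_nat n)"
  by (auto simp: limited_def)

lemma limited_1 [simp]: "limited 1"
  using limited_of_nat[of 1] by (simp del: limited_of_nat)

lemma pos_infinite_le: "pos_infinite a \<Longrightarrow> a \<le> b \<Longrightarrow> pos_infinite b"
  unfolding pos_infinite_def by (meson less_le_trans)

lemma pos_infinite_pos: "pos_infinite a \<Longrightarrow> 0 < a"
  unfolding pos_infinite_def by (metis of_nat_0)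

lemma pos_infinite_iff_not_limited: "pos_infinite a \<longleftrightarrow> 0 < a \<and> \<not> limited a"
  using pos_infinite_pos[of a] by (auto simp: pos_infinite_def limited_def not_le)

lemma pos_infinite_iff_inverse: "pos_infinite a \<longleftrightarrow> 0 < a \<and> infinitesimal (inverse a)"
proof -
  have "of_nat n < a \<longleftrightarrow> of_nat n * \<bar>inverse a\<bar> < 1" if "0 < a" for n
    using that by (simp add: field_simps)
  then show ?thesis using pos_infinite_pos[of a] by (auto simp: pos_infinite_def infinitesimal_def)
qed

lemma pos_infinite_inverse: "infinitesimal d \<Longrightarrow> 0 < d \<Longrightarrow> pos_infinite (inverse d)"
  by (simp add: pos_infinite_iff_inverse)

lemma pos_infinite_add_limited:
  assumes "pos_infinite a" "limited b"
  shows "pos_infinite (a + b)"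
  unfolding pos_infinite_def
proof
  fix n :: nat
  obtain m :: nat where "\<bar>b\<bar> \<le> of_nat m" using assms(2) by (auto simp: limited_def)
  moreover have "of_nat (n + m) < a" using assms(1) unfolding pos_infinite_def by blast
  ultimately show "of_nat n < a + b" by simp
qed

lemma pos_infinite_mult_ge:
  assumes a: "pos_infinite a" and "of_nat (Suc k) * b \<ge> 1"
  shows "pos_infinite (a * b)"
  unfolding pos_infinite_def
proof
  fix n :: nat
  have a0: "0 < a" using a by (rule pos_infinite_pos)
  have b0: "0 < b"
  proof (rule ccontr)
    assume "\<not> 0 < b"
    then have "of_nat (Suc k) * b \<le> 0" by (intro mult_nonneg_nonpos) (auto simp del: of_nat_Suc)
    with assms(2) show False by linarith
  qed
  have "of_nat (n * Suc k) < a" using a unfolding pos_infinite_def by blast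
  then have "of_nat (n * Suc k) * b < a * b" using b0 by (rule mult_strict_right_mono)
  moreover have "of_nat n * 1 \<le> of_nat n * (of_nat (Suc k) * b)"
    using assms(2) by (rule mult_left_mono) simp
  moreover have "of_nat (n * Suc k) * b = of_nat n * (of_nat (Suc k) * b)"
    by (simp only: of_nat_mult mult.assoc)
  ultimately show "of_nat n < a * b" by (metis le_less_trans mult_1_right)
qed

lemma pos_infinite_half: "pos_infinite a \<Longrightarrow> pos_infinite (a / 2)"
  using pos_infinite_mult_ge[of a 1 "1/2"] by simp

lemma pos_infinite_mult: "pos_infinite a \<Longrightarrow> pos_infinite b \<Longrightarrow> pos_infinite (a * b)"
  using pos_infinite_mult_ge[of a 0 b] unfolding pos_infinite_def
  by (metis less_imp_le mult_1 of_nat_1 One_nat_def)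

lemma infinitesimal_divide: "limited a \<Longrightarrow> pos_infinite b \<Longrightarrow> infinitesimal (a / b)"
  using infinitesimal_mult'[of a "inverse b"] by (simp add: pos_infinite_iff_inverse divide_inverse)

section \<open>H-fields over the reals\<close>

locale real_H_field = H_field_with_inversion \<O> D x cmp
  for \<O> :: "'k::{linordered_field, real_algebra_1} set" and D :: "'k \<Rightarrow> 'k" and x :: 'k
    and cmp :: "'k \<Rightarrow> 'k \<Rightarrow> 'k" (infixl \<open>\<odot>\<close> 72) +
  assumes constants_eq: "constants D = range of_real"
begin

text \<open>The type classes do not tie the order of the field to \<open>of_real\<close>;
  compatibility comes from nonnegative reals being squares.\<close>

lemma of_real_nonneg:
  assumes "0 \<le> r"
  shows "(0::'k) \<le> of_real r"
proof -
  have "of_real r = (of_real (sqrt r) * of_real (sqrt r) :: 'k)"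
    using assms by (simp add: of_real_mult[symmetric] del: of_real_mult)
  then show ?thesis by simp
qed

lemma of_real_le_iff_field: "(of_real r :: 'k) \<le> of_real s \<longleftrightarrow> r \<le> s"
proof
  assume "(of_real r :: 'k) \<le> of_real s"
  then show "r \<le> s" using of_real_nonneg[of "r - s"] by (cases "r \<le> s") auto
next
  assume "r \<le> s"
  then show "(of_real r :: 'k) \<le> of_real s" using of_real_nonneg[of "s - r"] by simp
qed

lemma limited_of_real [simp]: "limited (of_real r :: 'k)"
proof -
  obtain n :: nat where n: "\<bar>r\<bar> \<le> of_nat n" using real_arch_simple by blast
  then have "r \<le> of_nat n" "- of_nat n \<le> r" by auto
  then have "(of_real r :: 'k) \<le> of_real (of_nat n)" "(of_real (- of_nat n) :: 'k) \<le> of_real r"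
    by (simp_all only: of_real_le_iff_field)
  then show ?thesis unfolding limited_def by (intro exI[of _ n]) (simp add: abs_le_iff)
qed

lemma above_constants_eq: "above_constants D = Collect pos_infinite"
proof -
  have "(\<forall>r. of_real r < a) \<longleftrightarrow> pos_infinite a" for a :: 'k
  proof
    assume "\<forall>r. of_real r < a"
    then show "pos_infinite a" unfolding pos_infinite_def by (metis of_real_of_nat_eq)
  next
    assume a: "pos_infinite a"
    show "\<forall>r. of_real r < a"
    proof
      fix r :: real
      obtain n :: nat where "r \<le> of_nat n" using real_arch_simple by blast
      then have "(of_real r :: 'k) \<le> of_real (of_nat n)" by (simp only: of_real_le_iff_field)
      also have "\<dots> < a" using a by (simp add: pos_infinite_def)
      finally show "of_real r < a" .
    qed
  qed
  then show ?thesis by (auto simp: above_constants_def constants_eq)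
qed

lemma \<O>_if_limited:
  assumes "limited a"
  shows "a \<in> \<O>"
proof -
  have 0: "0 \<in> \<O>" using diff_in[OF one_in one_in] by simp
  have add: "a + b \<in> \<O>" if "a \<in> \<O>" "b \<in> \<O>" for a b
    using diff_in[OF that(1) diff_in[OF 0 that(2)]] by simp
  have nat: "of_nat n \<in> \<O>" for n by (induction n) (auto intro: 0 add one_in)
  obtain n :: nat where "\<bar>a\<bar> \<le> of_nat n" using assms by (auto simp: limited_def)
  then have "0 - of_nat n \<le> a" "a \<le> of_nat n" by auto
  then show ?thesis
    using convex nat[of n] diff_in[OF 0 nat[of n]] unfolding convex_in_def by blast
qed

lemma infinitesimal_if_max_ideal:
  assumes "e \<in> max_ideal \<O>"
  shows "infinitesimal e"
proof (rule ccontr)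
  assume "\<not> infinitesimal e"
  then obtain n :: nat where n: "1 \<le> of_nat n * \<bar>e\<bar>" by (auto simp: infinitesimal_def not_less)
  then have e: "e \<noteq> 0" by auto
  have "\<bar>inverse e\<bar> \<le> of_nat n" using n e by (simp add: field_simps)
  then have "inverse e \<in> \<O>" by (intro \<O>_if_limited) (auto simp: limited_def)
  then show False using assms e by (auto simp: max_ideal_def)
qed

text \<open>By HF1 an element of the ring is within an infinitesimal of a constant, hence of a real
  number. Real constants thus force the valuation ring to be the convex hull of the
  integers.\<close>

lemma limited_if_\<O>:
  assumes "a \<in> \<O>"
  shows "limited a"
proof -
  obtain r where "infinitesimal (a - of_real r)"
    using HF1[OF assms] infinitesimal_if_max_ideal by (auto simp: constants_eq)
  then have "limited (a - of_real r + of_real r)"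
    by (intro limited_add infinitesimal_limited limited_of_real)
  then show ?thesis by simp
qed

lemma max_ideal_iff: "e \<in> max_ideal \<O> \<longleftrightarrow> infinitesimal e"
proof
  assume e: "infinitesimal e"
  have "e * b \<noteq> 1" if "b \<in> \<O>" for b
    using infinitesimal_mult[OF e limited_if_\<O>[OF that]] not_infinitesimal_one by metis
  then show "e \<in> max_ideal \<O>"
    using e by (auto simp: max_ideal_def intro: \<O>_if_limited infinitesimal_limited)
qed (rule infinitesimal_if_max_ideal)

lemma standard_part: "limited a \<Longrightarrow> \<exists>r. infinitesimal (a - of_real r)" for a :: 'k
  using HF1[OF \<O>_if_limited, of a] by (auto simp: constants_eq max_ideal_iff)

lemma D_of_real [simp]: "D (of_real r) = 0"
proof -
  have "of_real r \<in> constants D" by (simp add: constants_eq)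
  then show ?thesis by (simp add: constants_def)
qed

lemma D_0 [simp]: "D 0 = 0"
  using D_of_real[of 0] by simp

lemma D_1 [simp]: "D 1 = 0"
  using D_of_real[of 1] by simp

lemma D_of_nat [simp]: "D (of_nat n) = 0"
  using D_of_real[of "of_nat n"] by simp

lemma D_minus: "D (- a) = - D a"
  using D_add[of a "- a"] by (simp add: add_eq_0_iff)

lemma D_diff: "D (a - b) = D a - D b"
  using D_add[of a "- b"] by (simp add: D_minus)

lemma D_divide:
  assumes "b \<noteq> 0"
  shows "D (a / b) = (D a * b - a * D b) / (b * b)"
proof -
  have "D a = D (a / b) * b + a / b * D b" using D_mult[of "a / b" b] assms by simp
  then show ?thesis using assms by (simp add: field_simps)
qed

lemma D_inverse: "b \<noteq> 0 \<Longrightarrow> D (inverse b) = - D b / (b * b)"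
  using D_divide[of b 1] by (simp add: inverse_eq_divide)

lemma D_pos: "pos_infinite a \<Longrightarrow> 0 < D a"
  using HF2 by (simp add: above_constants_eq)

lemma pos_infinite_x [simp]: "pos_infinite x"
  using x_above by (simp add: above_constants_eq)

text \<open>For every \<open>n\<close> both \<open>x + n * w\<close> and \<open>x - n * w\<close>
  stay above \<open>x / 2\<close>, hence infinite, and HF2 makes their derivatives
  \<open>1 + n * D w\<close> and \<open>1 - n * D w\<close> positive. In this way a sign condition
  yields a bound on derivatives.\<close>

lemma infinitesimal_D:
  assumes "infinitesimal (w / x)"
  shows "infinitesimal (D w)"
  unfolding infinitesimal_def
proof
  fix n :: nat
  have x0: "0 < x" using pos_infinite_x by (rule pos_infinite_pos)
  have "of_nat (2 * n) * \<bar>w / x\<bar> < 1" using assms unfolding infinitesimal_def by blast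
  then have "2 * (of_nat n * \<bar>w\<bar>) < x" using x0 by (simp add: field_simps)
  moreover have "\<bar>of_nat n * w\<bar> = of_nat n * \<bar>w\<bar>" by (simp add: abs_mult)
  ultimately have "x / 2 \<le> x + of_nat n * w" "x / 2 \<le> x - of_nat n * w"
    by (simp_all add: field_simps)
  then have "pos_infinite (x + of_nat n * w)" "pos_infinite (x - of_nat n * w)"
    using pos_infinite_le[OF pos_infinite_half[OF pos_infinite_x]] by blast+
  from this[THEN D_pos] have "0 < 1 + of_nat n * D w" "0 < 1 - of_nat n * D w"
    by (simp_all add: D_add D_diff D_mult D_x)
  then have "\<bar>of_nat n * D w\<bar> < 1" by (simp add: abs_less_iff)
  then show "of_nat n * \<bar>D w\<bar> < 1" by (simp add: abs_mult)
qed

lemma infinitesimal_D_limited: "limited w \<Longrightarrow> infinitesimal (D w)"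
  by (intro infinitesimal_D infinitesimal_divide) simp_all

end

section \<open>Arithmetic of composition and a first-order Taylor estimate\<close>

context real_H_field
begin

context
  fixes b :: 'k assumes b [simp]: "pos_infinite b"
begin

lemma above_constants_if_pos_infinite [simp]: "b \<in> above_constants D"
  by (simp add: above_constants_eq)

lemma comp_add: "(a + c) \<odot> b = a \<odot> b + c \<odot> b"
  by (rule HFC1_add) simp

lemma comp_mult: "(a * c) \<odot> b = (a \<odot> b) * (c \<odot> b)"
  by (rule HFC1_mult) simp

lemma comp_1 [simp]: "1 \<odot> b = 1"
  by (rule HFC1_one) simp

lemma comp_of_real [simp]: "of_real r \<odot> b = of_real r"
  using HFC1_linear[of b "of_real r" 1] by (simp add: constants_eq)

lemma comp_0 [simp]: "0 \<odot> b = 0"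
  using comp_of_real[of 0] by simp

lemma comp_of_nat [simp]: "of_nat n \<odot> b = of_nat n"
  using comp_of_real[of "of_nat n"] by simp

lemma comp_numeral [simp]: "numeral n \<odot> b = numeral n"
  using comp_of_real[of "numeral n"] by simp

lemma comp_minus: "(- a) \<odot> b = - (a \<odot> b)"
  using comp_add[of a "- a"] by (simp add: add_eq_0_iff)

lemma comp_diff: "(a - c) \<odot> b = a \<odot> b - c \<odot> b"
  using comp_add[of a "- c"] by (simp add: comp_minus)

lemma comp_eq_0_iff [simp]: "a \<odot> b = 0 \<longleftrightarrow> a = 0"
proof
  assume "a \<odot> b = 0"
  then show "a = 0" using comp_mult[of a "inverse a"] by (cases "a = 0") auto
qed simp

lemma comp_inverse: "inverse a \<odot> b = inverse (a \<odot> b)"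
  using comp_mult[of a "inverse a"] by (cases "a = 0") (auto simp: inverse_unique)

lemma comp_divide: "(a / c) \<odot> b = (a \<odot> b) / (c \<odot> b)"
  by (simp add: divide_inverse comp_mult comp_inverse)

lemma comp_le: "a \<le> c \<Longrightarrow> a \<odot> b \<le> c \<odot> b"
  using HFC1_mono[of b] by (simp add: mono_def)

lemma comp_less: "a < c \<Longrightarrow> a \<odot> b < c \<odot> b"
  using comp_le[of a c] comp_eq_0_iff[of "c - a"] by (simp add: comp_diff order_less_le)

lemma comp_abs: "\<bar>a\<bar> \<odot> b = \<bar>a \<odot> b\<bar>"
  using comp_le[of a 0] comp_le[of 0 a] by (auto simp: abs_if comp_minus not_less)

lemma infinitesimal_comp: "infinitesimal a \<Longrightarrow> infinitesimal (a \<odot> b)"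
  unfolding infinitesimal_def using comp_less[of "of_nat n * \<bar>a\<bar>" 1 for n]
  by (simp add: comp_mult comp_abs)

lemma limited_comp: "limited a \<Longrightarrow> limited (a \<odot> b)"
  unfolding limited_def using comp_le[of "\<bar>a\<bar>" "of_nat n" for n]
  by (auto simp: comp_abs)

lemma pos_infinite_comp: "pos_infinite a \<Longrightarrow> pos_infinite (a \<odot> b)"
  unfolding pos_infinite_def using comp_less[of "of_nat n" a for n] by auto

lemma comp_x [simp]: "x \<odot> b = b"
  by (rule HFC4_left) simp

end

lemma comp_strict_mono:
  "\<lbrakk>pos_infinite u; pos_infinite b; pos_infinite d; b < d\<rbrakk> \<Longrightarrow> u \<odot> b < u \<odot> d"
  using HFC3_strict_mono[of u] by (simp add: above_constants_eq strict_mono_on_def)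

lemma comp_assoc: "\<lbrakk>pos_infinite b; pos_infinite d\<rbrakk> \<Longrightarrow> a \<odot> (b \<odot> d) = a \<odot> b \<odot> d"
  by (rule HFC2) (simp_all add: above_constants_eq)

text \<open>This is HFC5 at the point \<open>x\<close> with \<open>n = 1\<close>. Its smallness
  conditions hold because \<open>y\<close> is infinite while \<open>t\<close> and
  \<open>D y * t\<close> are limited; the error is relative to the linear term.\<close>

lemma taylor_first_order:
  assumes y: "pos_infinite y" and t: "limited t" and Dt: "limited (D y * t)"
  shows "\<exists>e. infinitesimal e \<and> y \<odot> (x + t) = y + D y * t * (1 + e)"
proof -
  have y0: "y \<noteq> 0" using pos_infinite_pos[OF y] by simp
  have "infinitesimal (t / y)" "infinitesimal (D y * t / y)"
    using t Dt y by (simp_all add: infinitesimal_divide)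
  moreover have "t / y * y = t" using y0 by simp
  ultimately have small: "t \<in> small \<O> y" and "((D y / y) \<odot> x) * t \<in> max_ideal \<O>"
    using y0 unfolding small_def by (auto simp: max_ideal_iff HFC4_right intro!: exI[of _ "t / y"])
  moreover have "x + t \<in> above_constants D"
    using pos_infinite_add_limited[OF pos_infinite_x t] by (simp add: above_constants_eq)
  ultimately have "y \<odot> (x + t) - (\<Sum>k\<le>1. ((D ^^ k) y \<odot> x) / fact k * t ^ k)
      \<in> small \<O> (((D ^^ 1) y \<odot> x) * t ^ 1)"
    by (intro HFC5) (simp_all add: above_constants_eq)
  then obtain e where "infinitesimal e" "y \<odot> (x + t) - y - D y * t = e * (D y * t)"
    by (auto simp: small_def max_ideal_iff HFC4_right algebra_simps)
  then show ?thesis by (intro exI[of _ e]) (simp add: algebra_simps)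
qed

abbreviation K where "K \<equiv> composition_group D x cmp"

lemma carrier_K [simp]: "b \<in> carrier K \<longleftrightarrow> pos_infinite b"
  by (simp add: composition_group_def above_constants_eq)

lemma mult_K [simp]: "a \<otimes>\<^bsub>K\<^esub> b = a \<odot> b"
  by (simp add: composition_group_def)

lemma one_K [simp]: "\<one>\<^bsub>K\<^esub> = x"
  by (simp add: composition_group_def)

sublocale K: ordered_group K
proof -
  interpret group K by (rule inversion)
  show "ordered_group K"
    by unfold_locales (simp_all add: comp_less comp_strict_mono)
qed

lemma pos_infinite_inv [simp]: "pos_infinite b \<Longrightarrow> pos_infinite (inv\<^bsub>K\<^esub> b)"
  using K.inv_closed[of b] by simp

lemma comp_inv [simp]: "pos_infinite b \<Longrightarrow> b \<odot> inv\<^bsub>K\<^esub> b = x"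
  using K.r_inv[of b] by simp

lemma inv_comp [simp]: "pos_infinite b \<Longrightarrow> inv\<^bsub>K\<^esub> b \<odot> b = x"
  using K.l_inv[of b] by simp

lemma conj_by_K: "K.conj_by b f = b \<odot> f \<odot> inv\<^bsub>K\<^esub> b"
  by (simp add: K.conj_by_def)

section \<open>Normal forms of limited translations under conjugation\<close>

lemma pos_infinite_of_real_mult:
  assumes "0 < r" and "pos_infinite (a :: 'k)"
  shows "pos_infinite (of_real r * a)"
proof -
  obtain k :: nat where "1 / r \<le> of_nat k" using real_arch_simple by blast
  then have "1 \<le> of_nat (Suc k) * r" using assms(1) by (simp add: field_simps)
  then have "(of_real 1 :: 'k) \<le> of_real (of_nat (Suc k) * r)" by (simp only: of_real_le_iff_field)
  then have "1 \<le> of_nat (Suc k) * (of_real r :: 'k)" by simp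
  from pos_infinite_mult_ge[OF assms(2) this] show ?thesis by (simp add: mult.commute)
qed

lemma conj_translation_appreciable:
  assumes q: "limited q" "0 < q" "\<not> infinitesimal q"
  shows "\<exists>b e. pos_infinite b \<and> infinitesimal e \<and> K.conj_by b (x + q) = x + 1 + e"
proof -
  obtain r where r: "infinitesimal (q - of_real r)" using standard_part[OF q(1)] by blast
  have "0 < r"
  proof (rule ccontr)
    assume "\<not> 0 < r"
    then have "of_real r \<le> (0::'k)" using of_real_le_iff_field[of r 0] by simp
    then have "\<bar>q\<bar> \<le> \<bar>q - of_real r\<bar>" using q(2) by simp
    with r have "infinitesimal q" by (rule infinitesimal_le)
    with q(3) show False ..
  qed
  \<comment> \<open>With \<open>r\<close> the standard part of \<open>q\<close>, conjugating by the
    homothety \<open>c * x\<close>, whose inverse is \<open>r * x\<close>, rescales the step from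
    \<open>r\<close> to 1.\<close>
  define c :: 'k where "c = of_real (1 / r)"
  define m :: 'k where "m = of_real r * x"
  have b: "pos_infinite (c * x)" and m: "pos_infinite m"
    unfolding c_def m_def using \<open>0 < r\<close> by (simp_all add: pos_infinite_of_real_mult del: of_real_divide)
  have cr: "c * of_real r = 1"
    using \<open>0 < r\<close> by (simp add: c_def of_real_mult[symmetric] del: of_real_mult)
  have xq: "pos_infinite (x + q)" using q(1) by (simp add: pos_infinite_add_limited)
  have comp_c: "c \<odot> d = c" if "pos_infinite d" for d using that by (simp add: c_def)
  have cxm: "(c * x) \<odot> m = x"
    using m cr by (simp add: comp_mult comp_c) (simp add: m_def mult.assoc[symmetric])
  then have "inv\<^bsub>K\<^esub> m = c * x" using b m by (intro K.inv_equality) auto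
  then have inv: "inv\<^bsub>K\<^esub> (c * x) = m" using m K.inv_inv[of m] by simp
  have "K.conj_by (c * x) (x + q) = c * (m + (of_real r + (q - of_real r) \<odot> m))"
    using m xq by (simp add: conj_by_K inv comp_mult comp_add comp_c comp_diff)
  also have "\<dots> = x + 1 + c * ((q - of_real r) \<odot> m)"
    by (simp add: m_def distrib_left mult.assoc[symmetric] cr)
  finally have "K.conj_by (c * x) (x + q) = x + 1 + c * ((q - of_real r) \<odot> m)" .
  moreover have "infinitesimal (c * ((q - of_real r) \<odot> m))"
    unfolding c_def by (intro infinitesimal_mult' infinitesimal_comp m r limited_of_real)
  ultimately show ?thesis using b by blast
qed

text \<open>A step of exactly 1 to leading order would call for an antiderivative of
  \<open>inverse d\<close>, whose existence is not assumed. A limited step bounded away from 0 is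
  enough, since it can be renormalised afterwards.\<close>

lemma conj_translation_infinitesimal:
  assumes d: "infinitesimal d" "0 < d"
  shows "\<exists>b q. pos_infinite b \<and> limited q \<and> 1 \<le> 4 * q \<and> K.conj_by b (x + d) = x + q"
proof -
  define h where "h = inverse d"
  have h: "pos_infinite h" unfolding h_def using d by (rule pos_infinite_inverse)
  have h0: "0 < h" and Dh: "0 < D h" using h by (rule pos_infinite_pos, rule D_pos)
  have x0: "0 < x" using pos_infinite_x by (rule pos_infinite_pos)
  have dh: "d = inverse h" by (simp add: h_def)
  \<comment> \<open>An approximate Abel function \<open>b\<close> of \<open>x + d\<close>: by Taylor, \<open>b \<odot> (x + d) - b\<close> is close to \<open>D b * d\<close>.\<close>
  have "\<exists>b. pos_infinite b \<and> limited (D b * d) \<and> 1 \<le> 2 * (D b * d)"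
  proof (cases "limited (x * D h / h)")
    case True
    \<comment> \<open>Here \<open>h\<close> grows at most polynomially, and the derivative of
      \<open>x * h\<close> is \<open>h\<close> times a limited factor that is at least 1.\<close>
    have "D (x * h) * d = 1 + x * D h / h"
      using h0 by (simp add: D_mult D_x dh field_simps)
    then show ?thesis
      using True Dh x0 h0 h by (intro exI[of _ "x * h"]) (auto intro!: pos_infinite_mult limited_add)
  next
    case False
    \<comment> \<open>Integration of \<open>(h / D h) * D h\<close> by parts gives this as leading
      term of an antiderivative of \<open>h\<close>. The relative error is the derivative of
      \<open>h / D h\<close>, which is infinitesimal because \<open>h / D h\<close> is infinitesimal
      relative to \<open>x\<close>.\<close>
    define b where "b = h * h / D h"
    have "inverse b = - D d"
      using h0 D_inverse[of h] by (simp add: b_def dh)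
    then have b: "pos_infinite b"
      using h0 Dh infinitesimal_D_limited[OF infinitesimal_limited[OF d(1)]]
      unfolding pos_infinite_iff_inverse by (simp add: b_def)
    have "pos_infinite (x * D h / h)"
      using False h0 Dh x0 by (simp add: pos_infinite_iff_not_limited)
    then have "infinitesimal (inverse (x * D h / h))" by (simp add: pos_infinite_iff_inverse)
    then have "infinitesimal (h / D h / x)" by (simp add: field_simps)
    then have inf: "infinitesimal (D (h / D h))" by (rule infinitesimal_D)
    have "D b * d = 1 + D (h / D h)"
    proof -
      have "D b = D h * (h / D h) + h * D (h / D h)" using D_mult[of h "h / D h"] by (simp add: b_def)
      then show ?thesis using h0 Dh by (simp add: dh field_simps)
    qed
    moreover have "2 * \<bar>D (h / D h)\<bar> < 1" using inf by (rule infinitesimal_less)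
    moreover have "limited (1 + D (h / D h))"
      using inf by (intro limited_add[OF limited_1] infinitesimal_limited)
    ultimately show ?thesis
      using b by (intro exI[of _ b]) auto
  qed
  then obtain b where b: "pos_infinite b" and lim: "limited (D b * d)" and ge: "1 \<le> 2 * (D b * d)"
    by blast
  obtain e where e: "infinitesimal e" and eq: "b \<odot> (x + d) = b + D b * d * (1 + e)"
    using taylor_first_order[OF b infinitesimal_limited[OF d(1)] lim] by blast
  define q where "q = (D b * d * (1 + e)) \<odot> inv\<^bsub>K\<^esub> b"
  have ib: "pos_infinite (inv\<^bsub>K\<^esub> b)" using b by simp
  have "limited (D b * d * (1 + e))"
    using lim infinitesimal_limited[OF e] by (intro limited_mult[of "D b * d"] limited_add) auto
  then have q: "limited q" unfolding q_def using ib limited_comp by blast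
  have "2 * \<bar>e\<bar> < 1" using e by (rule infinitesimal_less)
  then have "1 \<le> 2 * (1 + e)" by auto
  then have "1 * 1 \<le> (2 * (D b * d)) * (2 * (1 + e))" using ge by (intro mult_mono) auto
  then have "1 \<le> 4 * (D b * d * (1 + e))" by (simp add: algebra_simps)
  from comp_le[OF ib this] have "1 \<le> 4 * q" using ib by (simp add: q_def comp_mult)
  moreover have "K.conj_by b (x + d) = x + q"
    using b ib by (simp add: conj_by_K eq comp_add q_def)
  ultimately show ?thesis using b q by blast
qed

lemma conj_translation:
  assumes d: "limited d" "0 < d"
  shows "\<exists>b e. pos_infinite b \<and> infinitesimal e \<and> K.conj_by b (x + d) = x + 1 + e"
proof (cases "infinitesimal d")
  case True
  then obtain b q where b: "pos_infinite b" "limited q" "1 \<le> 4 * q" "K.conj_by b (x + d) = x + q"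
    using conj_translation_infinitesimal d by blast
  then have "0 < q" "\<not> infinitesimal q" using infinitesimal_less[of q "num.Bit0 (num.Bit0 num.One)"] by auto
  then obtain b' e where "pos_infinite b'" "infinitesimal e" "K.conj_by b' (x + q) = x + 1 + e"
    using conj_translation_appreciable b by blast
  then show ?thesis
    using b K.conj_by_conj_by[of b' b "x + d"] d(1)
    by (intro exI[of _ "b' \<odot> b"] exI[of _ e]) (auto simp: pos_infinite_comp pos_infinite_add_limited)
qed (use assms conj_translation_appreciable in blast)

section \<open>Commutation inequalities\<close>

lemma commutation_fast:
  assumes f: "pos_infinite f" "x \<le> of_nat n * (f - x)" and e: "infinitesimal e"
  shows "(x + 1 + e) \<odot> f < f \<odot> (x + 1 + e)"
proof -
  let ?g = "x + 1 + e"
  \<comment> \<open>The claim will be read off from \<open>u < u \<odot> ?g\<close>, which holds since \<open>u\<close> is infinite.\<close>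
  define u where "u = of_nat (2 * n) * f - of_nat (2 * n + 1) * x"
  have "x \<le> u" using f(2) by (simp add: u_def algebra_simps)
  then have u: "pos_infinite u" by (rule pos_infinite_le[OF pos_infinite_x])
  have g: "pos_infinite ?g"
    using e by (simp add: pos_infinite_add_limited infinitesimal_limited)
  have n0: "0 < n" using f(2) pos_infinite_pos[OF pos_infinite_x] by (cases n) auto
  have small: "of_nat m * \<bar>e\<bar> < 1" "of_nat m * \<bar>e \<odot> f\<bar> < 1" for m
    using e infinitesimal_comp[OF f(1) e] unfolding infinitesimal_def by blast+
  have "2 * \<bar>e\<bar> < 1" using e by (rule infinitesimal_less)
  then have "x < ?g" by auto
  then have "u < u \<odot> ?g" using comp_strict_mono[OF u _ g, of x] by (simp add: HFC4_right)
  then have "of_nat (2 * n + 1) * (1 + e) < of_nat (2 * n) * (f \<odot> ?g - f)"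
    using g by (simp add: u_def comp_diff comp_mult comp_add algebra_simps)
  \<comment> \<open>The coefficient \<open>2 * n + 1\<close> against \<open>2 * n\<close> leaves a
    surplus of 1, which absorbs both infinitesimal terms. Doubling \<open>n\<close> made room for
    it: \<open>2 * n * (f - x)\<close> is at least \<open>2 * x\<close>, of which one
    \<open>x\<close> is spent on the surplus and the other keeps \<open>u\<close> infinite.\<close>
  moreover have "of_nat (2 * n) * (1 + e \<odot> f) \<le> of_nat (2 * n + 1) * (1 + e)"
  proof -
    have "of_nat (2 * n) * (e \<odot> f) - of_nat (2 * n + 1) * e
        \<le> of_nat (2 * n) * \<bar>e \<odot> f\<bar> + of_nat (2 * n + 1) * \<bar>e\<bar>"
      using mult_left_mono[OF abs_ge_self[of "e \<odot> f"], of "of_nat (2 * n)"]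
        mult_left_mono[OF abs_ge_minus_self[of e], of "of_nat (2 * n + 1)"]
      by (simp del: of_nat_Suc of_nat_mult of_nat_add)
    moreover have "2 * (of_nat (2 * n) * \<bar>e \<odot> f\<bar>) < 1" "2 * (of_nat (2 * n + 1) * \<bar>e\<bar>) < 1"
      using small(2)[of "2 * (2 * n)"] small(1)[of "2 * (2 * n + 1)"] by (simp_all add: algebra_simps)
    ultimately show ?thesis by (simp add: algebra_simps)
  qed
  ultimately have "of_nat (2 * n) * (1 + e \<odot> f) < of_nat (2 * n) * (f \<odot> ?g - f)" by linarith
  then have "1 + e \<odot> f < f \<odot> ?g - f" using n0 by (simp add: mult_less_cancel_left_pos)
  then show ?thesis using f(1) by (simp add: comp_add algebra_simps)
qed

text \<open>The bounding elements are conjugates of \<open>x + 1\<close>, so an \<open>f\<close>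
  beyond a convex normal subgroup containing \<open>x + 1\<close> must have \<open>f - x\<close> at
  least a positive rational multiple of \<open>x\<close>. The inequality amounts to
  \<open>h \<odot> f \<le> h + 1\<close>; it is obtained from an \<open>h\<close> growing more
  slowly than the square root of \<open>x\<close>.\<close>

lemma bounded_by_conj_translation:
  assumes f: "pos_infinite f" "x < f" "\<And>n. of_nat n * (f - x) < x"
  shows "\<exists>h. pos_infinite h \<and> f \<le> inv\<^bsub>K\<^esub> h \<odot> (h + 1)"
proof -
  have x0: "0 < x" using pos_infinite_x by (rule pos_infinite_pos)
  define h where "h = x / (f - x)"
  have h: "pos_infinite h"
    unfolding pos_infinite_def h_def using f by (simp add: pos_less_divide_eq)
  have h0: "0 < h" using h by (rule pos_infinite_pos)
  have f_eq: "f = x + x / h" using x0 f(2) by (simp add: h_def)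
  \<comment> \<open>When \<open>h\<close> grows too fast, \<open>h'\<close> is the cube root of \<open>x\<close>, the compositional inverse of \<open>x * x * x\<close>.\<close>
  obtain h' where h': "pos_infinite h'" "h' \<le> h" "pos_infinite (x / (h' * h'))"
  proof (cases "pos_infinite (x / (h * h))")
    case False
    then obtain n :: nat where "x / (h * h) \<le> of_nat n" by (auto simp: pos_infinite_def not_less)
    then have n: "x \<le> of_nat n * (h * h)" using h0 by (simp add: pos_divide_le_eq)
    \<comment> \<open>As \<open>q * q * q = x\<close>, the quotient \<open>x / (q * q)\<close> is
      \<open>q\<close>, which is infinite; and \<open>h < q\<close> would give
      \<open>n * (h * h) < q * (q * q) = x\<close>, against the bound on \<open>x\<close>.\<close>
    define q where "q = inv\<^bsub>K\<^esub> (x * x * x)"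
    have "pos_infinite (x * x * x)" by (intro pos_infinite_mult) simp_all
    then have q: "pos_infinite q" and "(x * x * x) \<odot> q = x" by (simp_all add: q_def)
    then have qqq: "q * q * q = x" by (simp add: comp_mult)
    have q0: "0 < q" using q by (rule pos_infinite_pos)
    have "q \<le> h"
    proof (rule ccontr)
      assume "\<not> q \<le> h"
      then have "h < q" by simp
      then have "h * h < q * q" using h0 by (intro mult_strict_mono) auto
      moreover have "of_nat n < q" using q by (simp add: pos_infinite_def)
      ultimately have "of_nat n * (h * h) < q * (q * q)" using h0 q0
        by (intro mult_strict_mono[of _ q "h * h"]) auto
      with n qqq show False by (simp add: mult.assoc)
    qed
    moreover have "x / (q * q) = q" using qqq q0 by (simp add: field_simps)
    ultimately show ?thesis using q that by metis
  qed (use h that in blast)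
  have h'0: "0 < h'" using h'(1) by (rule pos_infinite_pos)
  define k where "k = x + x / h'"
  have "f \<le> k" unfolding f_eq k_def using h'(2) h'0 x0 by (simp add: divide_left_mono)
  have k: "pos_infinite k" "x < k"
    using \<open>f \<le> k\<close> f(1,2) pos_infinite_le by auto
  define H where "H = h' \<odot> k"
  have H: "pos_infinite H" unfolding H_def using k(1) h'(1) by (rule pos_infinite_comp)
  have H0: "0 < H" using H by (rule pos_infinite_pos)
  \<comment> \<open>The infinite element \<open>x / (h' * h')\<close> increases under composition
    with \<open>k > x\<close>; clearing denominators bounds \<open>H * H\<close> by
    \<open>h' * h' + h'\<close>.\<close>
  have "x / (h' * h') < k / (H * H)"
    using comp_strict_mono[OF h'(3) _ k(1), of x] k by (simp add: HFC4_right comp_divide comp_mult H_def)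
  then have "x * (H * H) < k * (h' * h')"
    using H0 h'0 by (simp add: field_simps)
  also have "\<dots> = x * (h' * h' + h')" using h'0 by (simp add: k_def field_simps)
  finally have "H * H < h' * h' + h'" using x0 by (simp add: mult_less_cancel_left_pos)
  also have "\<dots> < (h' + 1) * (h' + 1)" using h'0 by (simp add: algebra_simps)
  finally have "H < h' + 1" using H0 h'0 by (metis add_pos_pos less_imp_le mult_mono not_less zero_less_one)
  then have "inv\<^bsub>K\<^esub> h' \<odot> H < inv\<^bsub>K\<^esub> h' \<odot> (h' + 1)"
    using h' H by (intro comp_strict_mono pos_infinite_add_limited) auto
  moreover have "inv\<^bsub>K\<^esub> h' \<odot> H = k"
    using h' k by (simp add: H_def comp_assoc)
  ultimately show ?thesis using \<open>f \<le> k\<close> h'(1) by (intro exI[of _ h']) auto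
qed

text \<open>Expanding both composites reduces the claim to \<open>e - E < d - d'\<close>, where
  \<open>E\<close> is \<open>e\<close> composed with \<open>x + d\<close> and \<open>d'\<close> is
  \<open>d\<close> composed with \<open>x + 1 + e\<close>. Both sides are measured against
  \<open>D y * d / y\<close>: a limited \<open>D y\<close> permits Taylor estimates for
  \<open>y\<close>, and since \<open>h / y\<close> does not decrease, \<open>d\<close> drops by at
  least a quarter of this scale, while \<open>e - E\<close> is below an eighth of it.\<close>

lemma commutation_infinitesimal:
  assumes e: "infinitesimal e" and d: "infinitesimal d" "0 < d"
  shows "(x + d) \<odot> (x + 1 + e) < (x + 1 + e) \<odot> (x + d)"
proof -
  let ?f = "x + 1 + e" and ?g = "x + d"
  have le: "limited e" and ld: "limited d" using e d by (simp_all add: infinitesimal_limited)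
  have f: "pos_infinite ?f" and g: "pos_infinite ?g"
    using le ld by (simp_all add: pos_infinite_add_limited)
  have e1: "100 * \<bar>e\<bar> < 1" using e by (rule infinitesimal_less)
  have xf: "x < ?f" using e1 by auto
  have x0: "0 < x" using pos_infinite_x by (rule pos_infinite_pos)
  define h where "h = inverse d"
  have h: "pos_infinite h" unfolding h_def using d by (rule pos_infinite_inverse)
  have h0: "0 < h" using h by (rule pos_infinite_pos)
  \<comment> \<open>\<open>y\<close> is the slower of \<open>x\<close> and \<open>h\<close>.\<close>
  obtain y where y: "pos_infinite y" and lDy: "limited (D y)" and hy: "h / y \<le> (h / y) \<odot> ?f"
  proof (cases "pos_infinite (h / x)")
    case True
    have "h / x < (h / x) \<odot> ?f"
      using comp_strict_mono[OF True _ f xf] by (simp add: HFC4_right)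
    then show ?thesis using that[of x] by (simp add: D_x)
  next
    case False
    then obtain n :: nat where "h / x \<le> of_nat n" by (auto simp: pos_infinite_def not_less)
    then have "h \<le> of_nat n * x" using x0 by (simp add: pos_divide_le_eq)
    then have "x \<le> of_nat (Suc n) * x - h" by (simp add: algebra_simps)
    then have "0 < D (of_nat (Suc n) * x - h)" by (intro D_pos pos_infinite_le[OF pos_infinite_x])
    then have "\<bar>D h\<bar> \<le> of_nat (Suc n)"
      using D_pos[OF h] by (simp add: D_diff D_mult D_x D_add algebra_simps)
    then have "limited (D h)" unfolding limited_def by blast
    then show ?thesis using that[of h] h h0 f by simp
  qed
  have y0: "0 < y" and Dy: "0 < D y" using y by (rule pos_infinite_pos, rule D_pos)
  obtain e1 where e1: "infinitesimal e1" "y \<odot> (x + (1 + e)) = y + D y * (1 + e) * (1 + e1)"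
    using taylor_first_order[OF y, of "1 + e"] le lDy by (auto simp: limited_add limited_mult)
  obtain e2 where e2: "infinitesimal e2" "y \<odot> ?g = y + D y * d * (1 + e2)"
    using taylor_first_order[OF y, of d] ld lDy by (auto simp: limited_mult)
  define A where "A = y \<odot> ?f - y"
  define B where "B = y \<odot> ?g - y"
  have A_eq: "A = D y * ((1 + e) * (1 + e1))" using e1(2) by (simp add: A_def add.assoc mult.assoc)
  have s: "100 * \<bar>e\<bar> < 1" "100 * \<bar>e1\<bar> < 1" "100 * \<bar>e2\<bar> < 1"
    using e e1(1) e2(1) by (simp_all only: infinitesimal_less)
  have "(7 / 10) * (8 / 10) \<le> (1 + e) * (1 + e1)"
    using s by (intro mult_mono) auto
  then have "1 / 2 \<le> (1 + e) * (1 + e1)" by simp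
  then have "D y * (1 / 2) \<le> D y * ((1 + e) * (1 + e1))" using Dy by (intro mult_left_mono) auto
  then have A1: "D y / 2 \<le> A" unfolding A_eq by simp
  have "limited A" unfolding A_eq
    using lDy le infinitesimal_limited[OF e1(1)] by (intro limited_mult limited_add) auto
  then have "infinitesimal (A / y)" using y by (rule infinitesimal_divide)
  then have "2 * \<bar>A / y\<bar> < 1" by (rule infinitesimal_less)
  then have A2: "A \<le> y" using y0 A1 Dy by (simp add: field_simps)
  have "B = D y * d * (1 + e2)" using e2(2) by (simp add: B_def)
  moreover have "D y * d * (1 + e2) \<le> D y * d * 2" using s Dy d by (intro mult_left_mono) auto
  moreover have "0 < D y * d * (1 + e2)" using s Dy d by (intro mult_pos_pos) auto
  ultimately have B: "0 < B" "B \<le> 2 * (D y * d)" by simp_all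
  define E where "E = e \<odot> ?g"
  define d' where "d' = d \<odot> ?f"
  have "infinitesimal E" unfolding E_def using g e by (rule infinitesimal_comp)
  then have E: "100 * \<bar>E\<bar> < 1" by (rule infinitesimal_less)
  have d'0: "0 < d'" unfolding d'_def using comp_less[OF f d(2)] f by simp
  \<comment> \<open>As \<open>y * (1 + 32 * e)\<close> is infinite, it increases: this bounds the variation of \<open>e\<close> by that of \<open>y\<close>.\<close>
  have eE: "8 * y * (e - E) < D y * d"
  proof -
    have "y / 2 \<le> y * (1 + 32 * e)"
      using mult_left_mono[of "1/2" "1 + 32 * e" y] y0 s by simp
    then have "pos_infinite (y * (1 + 32 * e))"
      by (rule pos_infinite_le[OF pos_infinite_half[OF y]])
    from comp_strict_mono[OF this pos_infinite_x g] d(2)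
    have "y * (1 + 32 * e) < (y + B) * (1 + 32 * E)"
      using g by (simp add: HFC4_right comp_mult comp_add B_def E_def)
    \<comment> \<open>A factor 4 is lost, half of it here and half in
      \<open>B \<le> 2 * (D y * d)\<close>; so 32 leaves 8, which beats the 4 in the bound for
      \<open>d - d'\<close>.\<close>
    moreover have "B * (1 + 32 * E) \<le> B * 2" using E B by (intro mult_left_mono) auto
    moreover have "y * (1 + 32 * e) = y + 32 * (y * e)"
      "(y + B) * (1 + 32 * E) = y + 32 * (y * E) + B * (1 + 32 * E)"
      "8 * y * (e - E) = 8 * (y * e) - 8 * (y * E)"
      by (simp_all add: algebra_simps)
    ultimately show ?thesis using B by linarith
  qed
  have dd: "D y * d \<le> 4 * y * (d - d')"
  proof -
    have yA: "0 < y + A" using y0 A1 Dy by simp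
    \<comment> \<open>Since \<open>h / y\<close> does not decrease, the product \<open>d * y\<close>
      does not increase; the gain \<open>A\<close> of \<open>y\<close> therefore forces a drop of
      \<open>d\<close>.\<close>
    have "inverse d / y \<le> inverse d' / (y + A)"
      using hy f by (simp add: h_def comp_divide comp_inverse d'_def A_def)
    then have "inverse (d * y) \<le> inverse (d' * (y + A))" by (simp add: divide_inverse)
    then have "d' * (y + A) \<le> d * y"
      using d(2) y0 by (rule inverse_le_imp_le[OF _ mult_pos_pos])
    then have *: "d * A \<le> (d - d') * (y + A)" by (simp add: algebra_simps)
    have "0 \<le> d * A" using d A1 Dy by (intro mult_nonneg_nonneg) auto
    then have "0 \<le> d - d'" using * yA by (metis order_trans zero_le_mult_iff not_less)
    then have "(d - d') * (y + A) \<le> (d - d') * (2 * y)" using A2 by (intro mult_left_mono) auto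
    moreover have "d * (D y / 2) \<le> d * A" using A1 d by (intro mult_left_mono) auto
    ultimately show ?thesis using * by (simp add: algebra_simps)
  qed
  have "0 < D y * d" using Dy d by simp
  with eE dd have "y * (e - E) < y * (d - d')" by (simp add: algebra_simps)
  then have "e - E < d - d'" using y0 by (simp add: mult_less_cancel_left_pos)
  then show ?thesis using f g by (simp add: comp_add E_def d'_def)
qed

section \<open>The centraliser of \<open>x + 1\<close> and its scaling property\<close>

lemma limited_if_comp_fixed:
  assumes b: "pos_infinite b" "x < b" and w: "w \<odot> b = w"
  shows "limited w"
proof (rule ccontr)
  assume "\<not> limited w"
  then have "pos_infinite \<bar>w\<bar>"
    by (auto simp: pos_infinite_iff_not_limited limited_def)
  from comp_strict_mono[OF this pos_infinite_x b] show False
    by (simp add: HFC4_right comp_abs b w)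
qed

text \<open>After subtraction of the standard part, a nonzero infinitesimal remainder would have an
  infinite inverse that is again fixed, whereas infinite elements strictly increase under
  composition with \<open>b > x\<close>.\<close>

lemma comp_fixed_of_real:
  assumes b: "pos_infinite b" "x < b" and w: "w \<odot> b = w"
  shows "\<exists>r. w = of_real r"
proof -
  obtain r where r: "infinitesimal (w - of_real r)"
    using standard_part[OF limited_if_comp_fixed[OF assms]] by blast
  have "w - of_real r = 0"
  proof (rule ccontr)
    define v where "v = inverse (w - of_real r)"
    assume "w - of_real r \<noteq> 0"
    then have "pos_infinite \<bar>v\<bar>" using r
      unfolding pos_infinite_iff_inverse v_def by (simp add: infinitesimal_def)
    moreover have "v \<odot> b = v" using b w by (simp add: v_def comp_inverse comp_diff)
    then have "limited v" using b by (intro limited_if_comp_fixed[of b])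
    ultimately show False by (auto simp: pos_infinite_iff_not_limited limited_def)
  qed
  then show ?thesis by auto
qed

lemma pos_infinite_x_add [simp]: "limited q \<Longrightarrow> pos_infinite (x + q)"
  by (simp add: pos_infinite_add_limited)

lemma translation_commute:
  "(x + of_real r) \<odot> (x + of_real s) = (x + of_real s) \<odot> (x + of_real r)"
  by (simp add: comp_add)

lemma translation_in_centraliser: "x + of_real s \<in> centraliser K (x + of_real r)"
  by (simp add: centraliser_def translation_commute)

text \<open>If \<open>h\<close> commutes with \<open>x + 1\<close>, then \<open>h - x\<close> is
  periodic, that is, fixed by composition with \<open>x + 1\<close>, and fixed elements are
  real.\<close>

lemma centraliser_x_add_1: "centraliser K (x + 1) = range (\<lambda>s. x + of_real s)"
proof -
  have "h \<in> range (\<lambda>s. x + of_real s)" if "h \<in> centraliser K (x + 1)" for h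
  proof -
    have h: "pos_infinite h" "h \<odot> (x + 1) = (x + 1) \<odot> h" using that by (auto simp: centraliser_def)
    then have "(h - x) \<odot> (x + 1) = h - x" by (simp add: comp_diff comp_add)
    then obtain s where "h - x = of_real s" using comp_fixed_of_real[of "x + 1" "h - x"] by auto
    then have "h = x + of_real s" by (simp add: algebra_simps)
    then show ?thesis by blast
  qed
  then show ?thesis using translation_in_centraliser[of _ 1] by auto
qed

lemma translation_pow: "(x + of_real r) [^]\<^bsub>K\<^esub> n = x + of_real (of_nat n * r)"
proof (induction n)
  case (Suc n)
  then show ?case by (simp add: comp_add comp_mult algebra_simps)
qed simp

lemma preceq_translation:
  assumes "r \<noteq> 0" "limited q"
  shows "x + q \<preceq>\<^bsub>K\<^esub> x + of_real r"
proof -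
  obtain n :: nat where "\<bar>q\<bar> \<le> of_nat n" using assms(2) by (auto simp: limited_def)
  then have "x + of_real (- of_nat n) \<le> x + q" "x + q \<le> x + of_real (of_nat n)" by auto
  moreover have "x + of_real r \<noteq> x" using assms(1) by (simp add: of_real_eq_0_iff)
  ultimately show ?thesis
    unfolding gr_preceq_def one_K using translation_in_centraliser by blast
qed

text \<open>The inverse of \<open>x + e\<close> is not explicit; it is bounded by the explicit
  inverse of a real translation lying below \<open>x + e\<close>.\<close>

lemma group_abs_infinitesimal:
  assumes e: "infinitesimal e"
  shows "K.group_abs (x + e) \<le> x + of_real (1 / real (Suc n))"
proof -
  define r where "r = 1 / real (Suc n)"
  have "real (Suc n) * r = 1" by (simp add: r_def)
  then have "(of_real (real (Suc n) * r) :: 'k) = 1" by simp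
  then have nr: "of_nat (Suc n) * (of_real r :: 'k) = 1" by (simp only: of_real_mult of_real_of_nat_eq)
  have "of_nat (Suc n) * \<bar>e\<bar> < of_nat (Suc n) * (of_real r :: 'k)"
    unfolding nr using e unfolding infinitesimal_def by blast
  then have er: "\<bar>e\<bar> < of_real r" by (simp only: mult_less_cancel_left_pos of_nat_0_less_iff zero_less_Suc)
  have xe: "pos_infinite (x + e)" using e by (simp add: infinitesimal_limited)
  have "inv\<^bsub>K\<^esub> (x + of_real (- r)) = x + of_real r"
    by (rule K.inv_equality) (simp_all add: comp_add del: of_real_minus, simp)
  moreover have "inv\<^bsub>K\<^esub> (x + e) \<le> inv\<^bsub>K\<^esub> (x + of_real (- r))"
    using er xe by (subst K.inv_le_iff) (auto simp del: of_real_minus, simp)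
  ultimately show ?thesis
    using er unfolding r_def[symmetric] by (auto simp: K.group_abs_def)
qed

lemma translation_not_preceq_infinitesimal:
  assumes "steep_group K" and e: "infinitesimal e" and r: "r \<noteq> 0"
  shows "\<not> x + of_real r \<preceq>\<^bsub>K\<^esub> x + e"
proof
  interpret steep_group K by fact
  assume "x + of_real r \<preceq>\<^bsub>K\<^esub> x + e"
  moreover have xe: "pos_infinite (x + e)" using e by (simp add: infinitesimal_limited)
  moreover have "x + 1 \<preceq>\<^bsub>K\<^esub> x + of_real r" using r by (rule preceq_translation) simp
  ultimately have "x + 1 \<preceq>\<^bsub>K\<^esub> x + e" using preceq_trans[of "x + 1" "x + of_real r" "x + e"] by simp
  then obtain n :: nat where n: "K.group_abs (x + 1) \<le> K.group_abs (x + e) [^]\<^bsub>K\<^esub> n"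
    using preceq_iff_pow[of "x + 1" "x + e"] xe by auto
  \<comment> \<open>The step length is adapted to the exponent: \<open>n\<close> steps of length
    \<open>1 / Suc n\<close> do not reach 1.\<close>
  define s where "s = 1 / real (Suc n)"
  have "K.group_abs (x + e) [^]\<^bsub>K\<^esub> n \<le> (x + of_real s) [^]\<^bsub>K\<^esub> n"
    using group_abs_infinitesimal[OF e, of n] xe K.group_abs_closed[of "x + e"]
    unfolding s_def by (intro K.pow_mono_base) (auto simp del: of_real_divide)
  also have "\<dots> = x + of_real (of_nat n * s)" by (rule translation_pow)
  finally have "x + of_real 1 \<le> x + of_real (real n * s)"
    using n by (auto simp: K.group_abs_def)
  then have "1 \<le> real n * s" by (simp only: add_le_cancel_left of_real_le_iff_field)
  then show False by (simp add: s_def)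
qed

text \<open>An \<open>f\<close> comparable to \<open>x + 1\<close> has the form
  \<open>x + r + e\<close> with \<open>r\<close> a nonzero real and \<open>e\<close> infinitesimal.
  Then \<open>x + r\<close> approximates it, because \<open>x + r\<close> composed with the inverse
  of \<open>f\<close> differs from \<open>x\<close> by an infinitesimal.\<close>

lemma scaling_x_add_1:
  assumes "steep_group K"
  shows "scaling K (x + 1)"
proof -
  interpret steep_group K by fact
  have sub: "subgroup (centraliser K (x + 1)) K" by (rule K.centraliser_subgroup) simp
  have "comm_group (K\<lparr>carrier := centraliser K (x + 1)\<rparr>)"
  proof (rule group.group_comm_groupI)
    show "group (K\<lparr>carrier := centraliser K (x + 1)\<rparr>)" using sub by (rule K.subgroup_imp_group)
  qed (auto simp: centraliser_x_add_1 translation_commute)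
  moreover have "\<exists>g\<in>centraliser K (x + 1) - {x}. g \<sim>\<^bsub>K\<^esub> f"
    if f: "pos_infinite f" "f \<asymp>\<^bsub>K\<^esub> x + 1" for f
  proof -
    have x1: "x + 1 \<preceq>\<^bsub>K\<^esub> f" and f1: "f \<preceq>\<^bsub>K\<^esub> x + 1" using f(2) by (auto simp: gr_asymp_def)
    have "f \<noteq> x" using x1 by (auto simp: gr_preceq_def)
    with f1 obtain a b where "x + of_real a \<le> f" "f \<le> x + of_real b"
      by (auto simp: gr_preceq_def centraliser_x_add_1)
    then have "\<bar>f - x\<bar> \<le> \<bar>\<bar>of_real a\<bar> + \<bar>of_real b\<bar>\<bar>" by auto
    moreover have "limited \<bar>of_real a :: 'k\<bar>" for a
      using limited_of_real[of a] by (simp add: limited_def)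
    ultimately have "limited (f - x)" by (metis limited_le limited_add)
    then obtain r where r: "infinitesimal (f - x - of_real r)" using standard_part by blast
    define e where "e = f - x - of_real r"
    have e: "infinitesimal e" using r by (simp add: e_def)
    have f_eq: "f = x + (of_real r + e)" by (simp add: e_def)
    have r0: "r \<noteq> 0"
    proof
      assume "r = 0"
      then show False
        using translation_not_preceq_infinitesimal[OF assms e, of 1] x1 by (simp add: f_eq)
    qed
    have invf: "pos_infinite (inv\<^bsub>K\<^esub> f)" using f(1) by simp
    have "f \<odot> inv\<^bsub>K\<^esub> f = x" using f(1) by simp
    then have "inv\<^bsub>K\<^esub> f + of_real r + e \<odot> inv\<^bsub>K\<^esub> f = x"
      using invf by (subst (asm) f_eq) (simp add: comp_add add_ac)
    then have eq: "(x + of_real r) \<odot> inv\<^bsub>K\<^esub> f = x + (- (e \<odot> inv\<^bsub>K\<^esub> f))"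
      using invf by (simp add: comp_add algebra_simps)
    have e': "infinitesimal (- (e \<odot> inv\<^bsub>K\<^esub> f))" using infinitesimal_comp[OF invf e] by simp
    have "(x + of_real r) \<otimes>\<^bsub>K\<^esub> inv\<^bsub>K\<^esub> f \<prec>\<^bsub>K\<^esub> x + of_real r"
      unfolding gr_prec_def mult_K eq
      using translation_not_preceq_infinitesimal[OF assms e' r0]
        preceq_translation[OF r0 infinitesimal_limited[OF e']] by blast
    then have "x + of_real r \<sim>\<^bsub>K\<^esub> f"
      using \<open>f \<noteq> x\<close> r0 by (simp add: gr_sim_def)
    then show ?thesis using r0 by (intro bexI[of _ "x + of_real r"]) (auto simp: centraliser_x_add_1)
  qed
  ultimately show ?thesis by (simp add: scaling_def)
qed

lemma asymp_x_add_1: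
  assumes "steep_group K" and e: "infinitesimal e"
  shows "x + 1 \<asymp>\<^bsub>K\<^esub> x + 1 + e"
proof -
  interpret steep_group K by fact
  let ?f = "x + 1 + e"
  have e2: "2 * \<bar>e\<bar> < 1" using e by (rule infinitesimal_less)
  have f: "pos_infinite ?f" using e by (simp add: add.assoc limited_add infinitesimal_limited)
  have "2 * \<bar>e \<odot> ?f\<bar> < 1" using infinitesimal_comp[OF f e] by (rule infinitesimal_less)
  then have "x + 1 \<le> ?f \<odot> ?f" using e2 f by (simp add: comp_add)
  moreover have "K.group_abs ?f = ?f" "K.group_abs (x + 1) = x + 1" using e2 by (auto simp: K.group_abs_def)
  ultimately have "x + 1 \<preceq>\<^bsub>K\<^esub> ?f"
    using f preceq_iff_pow[of "x + 1" ?f] by (auto simp: numeral_2_eq_2 intro!: exI[of _ 2])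
  moreover have "?f \<preceq>\<^bsub>K\<^esub> x + 1"
    using preceq_translation[of 1 "1 + e"] e by (simp add: add.assoc limited_add infinitesimal_limited)
  ultimately show ?thesis by (simp add: gr_asymp_def)
qed

section \<open>Steepness of the composition group and the final assembly\<close>

lemma conj_into_translation:
  assumes cof: "cofinal_in G0 {a \<odot> (inv\<^bsub>K\<^esub> a + 1) | a. a \<in> G1}" and G1: "G1 \<subseteq> carrier K"
    and p: "p \<in> G0" "pos_infinite p" "x < p"
  shows "\<exists>b e. pos_infinite b \<and> infinitesimal e \<and> K.conj_by b p = x + 1 + e"
proof -
  obtain a where a: "pos_infinite a" "p \<le> a \<odot> (inv\<^bsub>K\<^esub> a + 1)"
  proof -
    obtain a where "a \<in> G1" "p \<le> a \<odot> (inv\<^bsub>K\<^esub> a + 1)"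
      using cof p(1) unfolding cofinal_in_def by blast
    then show thesis using that[of a] G1 carrier_K by blast
  qed
  have ia: "pos_infinite (inv\<^bsub>K\<^esub> a)" using a(1) by simp
  then have ia1: "pos_infinite (inv\<^bsub>K\<^esub> a + 1)" by (simp add: pos_infinite_add_limited)
  \<comment> \<open>Members of the cofinal family are conjugates of \<open>x + 1\<close>; undoing
    the conjugation places \<open>p\<close> between \<open>x\<close> and \<open>x + 1\<close>, where
    the step \<open>d\<close> is limited.\<close>
  have "K.conj_by a (x + 1) = a \<odot> (inv\<^bsub>K\<^esub> a + 1)"
    using a(1) ia comp_assoc[of "x + 1" "inv\<^bsub>K\<^esub> a" a] by (simp add: conj_by_K comp_add)
  then have "p \<le> K.conj_by a (x + 1)" using a(2) by simp
  moreover define d where "d = K.conj_by (inv\<^bsub>K\<^esub> a) p - x"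
  have pc: "p = K.conj_by a (x + d)"
    using a(1) p(2) K.conj_by_inv_conj_by[of a p] by (simp add: d_def)
  have xd: "pos_infinite (x + d)"
    using K.conj_by_closed[of "inv\<^bsub>K\<^esub> a" p] ia p(2) by (simp add: d_def)
  ultimately have "d \<le> 1"
    using K.conj_by_less_iff[of a "x + 1" "x + d"] a(1) by (simp add: pc[symmetric] not_less[symmetric])
  moreover have "0 < d"
    using p(3) K.conj_by_less_iff[of a x "x + d"] K.conj_by_one[of a] a(1) xd by (simp add: pc)
  ultimately have "limited d" using limited_le[OF limited_1, of d] by simp
  then obtain b e where b: "pos_infinite b" "infinitesimal e" "K.conj_by b (x + d) = x + 1 + e"
    using conj_translation \<open>0 < d\<close> by blast
  have "K.conj_by b (x + d) = K.conj_by (b \<odot> inv\<^bsub>K\<^esub> a) p"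
    using K.conj_by_conj_by[of b "inv\<^bsub>K\<^esub> a" p] b(1) ia p(2) by (simp add: d_def)
  then show ?thesis using b ia
    by (intro exI[of _ "b \<odot> inv\<^bsub>K\<^esub> a"] exI[of _ e]) (auto simp: pos_infinite_comp)
qed

text \<open>The claim is invariant under conjugation, and the normal form is available for elements
  of \<open>G0\<close> above \<open>x\<close>; hence \<open>f\<close> is normalised when it lies in
  \<open>G0\<close>, and \<open>g\<close> otherwise.\<close>

lemma steep_on_kernel:
  assumes G0: "normal G0 K" and conv: "convex_in (carrier K) G0" and x1: "x + 1 \<in> G0"
    and G1: "G1 \<subseteq> carrier K"
    and cof: "cofinal_in G0 {a \<odot> (inv\<^bsub>K\<^esub> a + 1) | a. a \<in> G1}"
    and fg: "pos_infinite f" "x < f" "g \<in> G0" "x < g" "\<forall>n::nat. g [^]\<^bsub>K\<^esub> n < f"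
  shows "g \<odot> f < f \<odot> g"
proof -
  interpret G0: normal G0 K by fact
  have x0: "0 < x" using pos_infinite_x by (rule pos_infinite_pos)
  have g: "pos_infinite g" using fg(3) G0.subset by auto
  have main: ?thesis if b: "pos_infinite b"
    and lt: "K.conj_by b g \<odot> K.conj_by b f < K.conj_by b f \<odot> K.conj_by b g" for b
    using lt K.conj_by_mult[of b f g] K.conj_by_mult[of b g f] K.conj_by_less_iff[of b "g \<odot> f" "f \<odot> g"]
      b fg(1) g by (simp add: pos_infinite_comp)
  have gt: "x < K.conj_by b p" if "pos_infinite b" "pos_infinite p" "x < p" for b p
    using K.conj_by_less_iff[of b x p] K.conj_by_one[of b] that by simp
  show ?thesis
  proof (cases "f \<in> G0")
    case True
    then obtain b e where b: "pos_infinite b" and e: "infinitesimal e" and f': "K.conj_by b f = x + 1 + e"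
      using conj_into_translation[OF cof G1] fg by blast
    define d where "d = K.conj_by b g - x"
    have g': "K.conj_by b g = x + d" by (simp add: d_def)
    have xd: "pos_infinite (x + d)" using K.conj_by_closed[of b g] b g by (simp add: d_def)
    have d0: "0 < d" using gt[OF b g fg(4)] by (simp add: d_def)
    have "infinitesimal d"
    proof (rule ccontr)
      assume "\<not> infinitesimal d"
      then obtain n :: nat where n: "1 \<le> of_nat n * d" using d0 by (auto simp: infinitesimal_def not_less)
      then have n0: "0 < n" by (cases n) auto
      define r where "r = 1 / real n"
      have nr: "real n * r = 1" using n0 by (simp add: r_def)
      then have "of_nat n * (of_real r :: 'k) = 1" by (metis of_real_1 of_real_mult of_real_of_nat_eq)
      then have "of_nat n * (of_real r :: 'k) \<le> of_nat n * d" using n by simp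
      then have "of_real r \<le> d" using n0 by (simp add: mult_le_cancel_left_pos)
      \<comment> \<open>Steps of length \<open>1 / n\<close>, repeated \<open>2 * n\<close> times,
        reach \<open>x + 2\<close>, whereas the powers of \<open>x + d\<close> stay below
        \<open>x + 1 + e\<close>.\<close>
      then have "(x + of_real r) [^]\<^bsub>K\<^esub> (2 * n) \<le> (x + d) [^]\<^bsub>K\<^esub> (2 * n)"
        using xd by (intro K.pow_mono_base) auto
      also have "\<dots> < x + 1 + e"
        using fg(5) K.conj_by_pow[of b g "2 * n"] K.conj_by_less_iff[of b "g [^]\<^bsub>K\<^esub> (2 * n)" f]
          b g fg(1) K.nat_pow_closed[of g "2 * n"] by (simp add: f' g')
      also have "(x + of_real r) [^]\<^bsub>K\<^esub> (2 * n) = x + of_real (2 * (real n * r))"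
        by (simp add: translation_pow mult.assoc)
      finally have "1 < e" by (simp add: nr)
      then show False using infinitesimal_less[OF e, of num.One] by simp
    qed
    then show ?thesis
      using commutation_infinitesimal[OF e _ d0] by (intro main[OF b]) (simp add: f' g')
  next
    case False
    obtain b e where b: "pos_infinite b" and e: "infinitesimal e" and g': "K.conj_by b g = x + 1 + e"
      using conj_into_translation[OF cof G1 fg(3) g fg(4)] by blast
    let ?f = "K.conj_by b f"
    have f': "pos_infinite ?f" using K.conj_by_closed[of b f] b fg(1) by simp
    have nin: "?f \<notin> G0"
    proof
      assume "?f \<in> G0"
      then have "K.conj_by (inv\<^bsub>K\<^esub> b) ?f \<in> G0"
        using G0.inv_op_closed2[of "inv\<^bsub>K\<^esub> b" ?f] b by (simp add: K.conj_by_def)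
      then show False
        using False b fg(1) K.conj_by_inv_eq_iff[of b ?f f] f' by simp
    qed
    have xf: "x < ?f" using b fg(1,2) by (rule gt)
    obtain n where "x \<le> of_nat n * (?f - x)"
    proof (rule ccontr)
      assume "\<not> thesis"
      then have "\<And>n. of_nat n * (?f - x) < x" using that by (meson not_less)
      then obtain h where h: "pos_infinite h" "?f \<le> inv\<^bsub>K\<^esub> h \<odot> (h + 1)"
        using bounded_by_conj_translation[OF f' xf] by blast
      \<comment> \<open>As a conjugate of \<open>x + 1\<close> this element lies in
        \<open>G0\<close>, and convexity would drag \<open>?f\<close>, which lies between
        \<open>x\<close> and it, into \<open>G0\<close>.\<close>
      have "inv\<^bsub>K\<^esub> h \<odot> (h + 1) = inv\<^bsub>K\<^esub> h \<odot> (x + 1) \<odot> h"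
        using h(1) comp_assoc[of "x + 1" h "inv\<^bsub>K\<^esub> h"] by (simp add: comp_add)
      then have "inv\<^bsub>K\<^esub> h \<odot> (h + 1) \<in> G0"
        using G0.inv_op_closed1[of h "x + 1"] h(1) x1 by simp
      moreover have "x \<in> G0" using G0.one_closed by simp
      ultimately have "?f \<in> G0"
        using conv h(2) f' xf unfolding convex_in_def by (meson carrier_K less_imp_le)
      with nin show False ..
    qed
    then show ?thesis
      using commutation_fast[OF f' _ e] by (intro main[OF b]) (simp add: g')
  qed
qed

text \<open>Steepness comes before any scaling element, since conjugating, lifting and restricting
  those rests on the description of \<open>\<preceq>\<close> by powers. For GOG3, an
  \<open>f\<close> in \<open>G0\<close> receives a conjugate of \<open>x + 1\<close>; any other
  \<open>f\<close> has a nontrivial projection and takes its scaling element from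
  \<open>G1\<close>.\<close>

lemma growth_order_extension:
  assumes G0: "normal G0 K" and conv: "convex_in (carrier K) G0" and x1: "x + 1 \<in> G0"
    and compl: "complement_in K G0 G1"
    and G1: "growth_order_group (K\<lparr>carrier := G1\<rparr>)" "archimedean_centralisers (K\<lparr>carrier := G1\<rparr>)"
    and cof: "cofinal_in G0 {a \<odot> (inv\<^bsub>K\<^esub> a + 1) | a. a \<in> G1}"
  shows "growth_order_group K \<and> archimedean_centralisers K \<and>
    growth_order_group (K\<lparr>carrier := G0\<rparr>) \<and> preceq_initial K G0"
proof -
  interpret G0: normal G0 K by fact
  obtain pr where retr: "monotone_retraction K G1 pr"
    and ker: "\<And>f. f \<in> carrier K \<Longrightarrow> pr f = \<one>\<^bsub>K\<^esub> \<longleftrightarrow> f \<in> G0"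
    using K.monotone_retraction_of_complement[OF G0 conv compl] by blast
  interpret pr: monotone_retraction K G1 pr by (rule retr)
  interpret G1: growth_order_group "K\<lparr>carrier := G1\<rparr>" by (rule G1)
  have steep_K: "steep_group K"
  proof (rule pr.steep_extension[OF steep_groupI[OF G1]])
    fix f g assume "f \<in> carrier K" "g \<in> carrier K" "\<one>\<^bsub>K\<^esub> < f" "\<one>\<^bsub>K\<^esub> < g" "pr g = \<one>\<^bsub>K\<^esub>"
      "\<forall>n::nat. g [^]\<^bsub>K\<^esub> n < f"
    then show "g \<otimes>\<^bsub>K\<^esub> f < f \<otimes>\<^bsub>K\<^esub> g"
      using steep_on_kernel[OF G0 conv x1 pr.H.subset cof, of f g] ker[of g] by simp
  qed
  interpret steep_group K by (rule steep_K)
  have scaling_G0: "\<exists>s. scaling K s \<and> s \<asymp>\<^bsub>K\<^esub> f" if f: "f \<in> G0" "f \<noteq> x" for f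
  proof -
    have fK: "f \<in> carrier K" using f(1) G0.subset by blast
    define p where "p = K.group_abs f"
    have pK: "pos_infinite p" using K.group_abs_closed[OF fK] by (simp add: p_def)
    have "p \<in> G0" using f(1) by (simp add: p_def K.group_abs_def)
    moreover have "x < p"
      using K.one_le_group_abs[OF fK] K.group_abs_eq_one_iff[OF fK] f(2) by (auto simp: p_def order_less_le)
    ultimately obtain b e where b: "pos_infinite b" and e: "infinitesimal e"
      and eq: "K.conj_by b p = x + 1 + e"
      using conj_into_translation[OF cof pr.H.subset _ pK] by blast
    define s where "s = K.conj_by (inv\<^bsub>K\<^esub> b) (x + 1)"
    have s: "scaling K s"
      using scaling_conj_by[OF _ scaling_x_add_1[OF steep_K], of "inv\<^bsub>K\<^esub> b"] b by (simp add: s_def)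
    then have sK: "s \<in> carrier K" by (simp add: scaling_def)
    have "K.conj_by b s \<asymp>\<^bsub>K\<^esub> K.conj_by b p"
      using asymp_x_add_1[OF steep_K e] b K.conj_by_inv_conj_by[of b "x + 1"] by (simp add: eq s_def)
    then have "s \<asymp>\<^bsub>K\<^esub> p" using b sK pK by (simp add: gr_asymp_def preceq_conj_by)
    moreover have "K.group_abs p = K.group_abs f"
      using K.one_le_group_abs[OF fK] by (simp add: p_def K.group_abs_def[of "K.group_abs f"])
    ultimately have "s \<asymp>\<^bsub>K\<^esub> f"
      using K.preceq_group_abs[of s p] K.preceq_group_abs[of s f]
        K.preceq_group_abs[of p s] K.preceq_group_abs[of f s] sK pK fK by (simp add: gr_asymp_def)
    with s show ?thesis by blast
  qed
  have "growth_order_group K"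
  proof (rule growth_order_groupI)
    fix f assume f: "f \<in> carrier K" "f \<noteq> \<one>\<^bsub>K\<^esub>"
    show "\<exists>s. scaling K s \<and> s \<asymp>\<^bsub>K\<^esub> f"
    proof (cases "f \<in> G0")
      case True
      then show ?thesis using scaling_G0 f by simp
    next
      case False
      then have "pr f \<noteq> \<one>\<^bsub>K\<lparr>carrier := G1\<rparr>\<^esub>" using ker[OF f(1)] by simp
      then obtain s where "scaling (K\<lparr>carrier := G1\<rparr>) s" "s \<asymp>\<^bsub>K\<lparr>carrier := G1\<rparr>\<^esub> pr f"
        using G1.GOG3[of "pr f"] pr.pr_in[OF f(1)] by auto
      then show ?thesis using pr.scaling_extension[OF steep_K] f(1) by blast
    qed
  qed
  moreover have "growth_order_group (K\<lparr>carrier := G0\<rparr>)"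
    using growth_order_group_convex_subgroup[OF G0.subgroup_axioms conv] scaling_G0 by simp
  moreover have "preceq_initial K G0"
    unfolding preceq_initial_def
    using G0.subset G0.one_closed convex_subgroup_preceq_closed[OF G0.subgroup_axioms conv] by blast
  ultimately show ?thesis using archimedean_centralisers by blast
qed

end

theorem theorem4p7:
  fixes \<O> :: "'k::{linordered_field, real_algebra_1} set"
    and D :: "'k \<Rightarrow> 'k"
    and x :: 'k
    and cmp :: "'k \<Rightarrow> 'k \<Rightarrow> 'k"
    and K :: "'k monoid"
    and G0 G1 :: "'k set"
  assumes "H_field_with_inversion \<O> D x cmp"
    and "constants D = range of_real"
    and K: "K = composition_group D x cmp"
    and "normal G0 K"
    and "convex_in (carrier K) G0"
    and "\<forall>r::real. x + of_real r \<in> G0"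
    and "complement_in K G0 G1"
    and "growth_order_group (K\<lparr>carrier := G1\<rparr>)"
    and "archimedean_centralisers (K\<lparr>carrier := G1\<rparr>)"
    and "cofinal_in G0 {cmp a (inv\<^bsub>K\<^esub> a + 1) | a. a \<in> G1}"
  shows "growth_order_group K \<and> archimedean_centralisers K \<and>
    growth_order_group (K\<lparr>carrier := G0\<rparr>) \<and> preceq_initial K G0"
proof -
  interpret H_field_with_inversion \<O> D x cmp by fact
  interpret real_H_field \<O> D x cmp by unfold_locales fact
  have "x + 1 \<in> G0" using assms(6)[rule_format, of 1] by simp
  then show ?thesis
    using assms(4,5,7-10) growth_order_extension unfolding K by blast
qed

end
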